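(* Let $\mathsf{C}\colon\{0,1\}^k\to\{0,1\}^n$ be a linear $(3,\delta)$-wLDC, and let $d\in\mathbb{N}$. Then there are codes $\mathsf{C}_2\colon\{0,1\}^{k_2}\to\{0,1\}^n$ and $\mathsf{C}_3\colon\{0,1\}^{k_3}\to\{0,1\}^N$ such that either $\mathsf{C}_2$ is a linear $\bigl(2,\ \Omega\bigl(\delta\cdot\frac{d}{d+k}\bigr)\bigr)$-wLDC or $\mathsf{C}_3$ is a linear $\bigl(2,\ \Omega(\delta^2/d)\bigr)$-wLDC, where $k_2,k_3\ge k/2$, $N=\binom{2n}{\ell}$ and $\ell=\sqrt{n/k}/c$, where $c$ is an absolute constant.
   Context: A hypergraph on $[n]=\{1,\dots,n\}$ is a collection of subsets of $[n]$ (hyperedges); it is $q$-uniform if every hyperedge has size exactly $q$, and a matching if its hyperedges are pairwise disjoint. A code $\mathsf{C}\colon\{0,1\}^k\to\{0,1\}^n$ is a linear $(q,\delta)$-weakly locally decodable code (linear $(q,\delta)$-wLDC) if $\mathsf{C}$ is a linear code (over $\mathbb{F}_2$) and there are $q$-uniform hypergraph matchings $\mathcal{H}_1,\dots,\mathcal{H}_k$ on $[n]$ such that (1) $\sum_{i=1}^k|\mathcal{H}_i|\ge\delta nk$, and (2) for every $i\in[k]$ and every $C\in\mathcal{H}_i$, $\bigoplus_{v\in C}\mathsf{C}(b)_v=b_i$ for all messages $b\in\{0,1\}^k$. The $\Omega(\cdot)$ notation hides absolute constants. *)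

theory Defs
  imports Complex_Main "HOL-Library.Z2" "HOL-Library.Disjoint_Sets" "Jordan_Normal_Form.Matrix"
begin

text \<open>
  Words in \<open>{0,1}^n\<close> are the vectors in \<^term>\<open>carrier_vec n :: bit vec set\<close>
  over the two-element field \<^typ>\<open>bit\<close>, so \<open>XOR\<close> is addition. Coordinates
  are numbered from \<open>0\<close>, and the vertex set \<open>[n]\<close> is accordingly \<^term>\<open>{..<n}\<close>.
\<close>

definition hypergraph_on :: "'a set \<Rightarrow> 'a set set \<Rightarrow> bool" where
  "hypergraph_on V H \<longleftrightarrow> H \<subseteq> Pow V"

definition uniform_hypergraph :: "nat \<Rightarrow> 'a set set \<Rightarrow> bool" where
  "uniform_hypergraph q H \<longleftrightarrow> (\<forall>e\<in>H. card e = q)"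

definition hypergraph_matching :: "'a set set \<Rightarrow> bool" where
  "hypergraph_matching H \<longleftrightarrow> disjoint H"

text \<open>A linear code is a linear encoding map; injectivity is not part of the notion.\<close>

definition linear_code :: "nat \<Rightarrow> nat \<Rightarrow> (bit vec \<Rightarrow> bit vec) \<Rightarrow> bool" where
  "linear_code k n C \<longleftrightarrow>
     (\<forall>x \<in> carrier_vec k. C x \<in> carrier_vec n) \<and>
     (\<forall>x \<in> carrier_vec k. \<forall>y \<in> carrier_vec k. C (x + y) = C x + C y) \<and>
     (\<forall>a. \<forall>x \<in> carrier_vec k. C (a \<cdot>\<^sub>v x) = a \<cdot>\<^sub>v C x)"

definition linear_wLDC ::
    "nat \<Rightarrow> real \<Rightarrow> nat \<Rightarrow> nat \<Rightarrow> (bit vec \<Rightarrow> bit vec) \<Rightarrow> bool" where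
  "linear_wLDC q \<delta> k n C \<longleftrightarrow>
     linear_code k n C \<and>
     (\<exists>H :: nat \<Rightarrow> nat set set.
        (\<forall>i<k. hypergraph_on {..<n} (H i) \<and> uniform_hypergraph q (H i)
               \<and> hypergraph_matching (H i)) \<and>
        real (\<Sum>i<k. card (H i)) \<ge> \<delta> * real n * real k \<and>
        (\<forall>i<k. \<forall>e \<in> H i. \<forall>b \<in> carrier_vec k. (\<Sum>v\<in>e. C b $ v) = b $ i))"

text \<open>
  The parameter \<open>sqrt (n/k) / c\<close> need not be an integer and is rounded up. Rounding down
  would give \<open>0\<close> whenever \<open>n < c^2 k\<close>, which leaves a single coordinate and hence
  no room for a two-query code.
\<close>

definition kikuchi_level :: "real \<Rightarrow> nat \<Rightarrow> nat \<Rightarrow> nat" where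
  "kikuchi_level c n k = nat \<lceil>sqrt (real n / real k) / c\<rceil>"

end

(*
  The triples in the union of the H_i, each labelled by its i, number at least delta n k. If
  delta k < 2, a code that only encodes one message bit is already good enough.

  Heavy case. Remove greedily groups of d + 1 triples sharing a common pair p. Two triples
  p + w and p + w' of one group with labels i, j satisfy C_w + C_w' = b_i + b_j. Setting b_j = 0
  for j outside a random set L of labels turns a quarter of these ordered pairs into 2-queries
  {w, w'} for b_i. Every such query meets O(d + k) others with the same label, so a maximal set
  of disjoint queries has the required size.

  Light case, n > 4k. If half of the triples survive, every pair lies in at most d of them. Two
  triples {x, x', w} and {y, y', w} give the 4-query x, x', y, y' for b_i + b_j, and hence for b_i
  after a cut L as above. Take x, x' from one copy of [n] and y, y' from another; the Kikuchi
  graph splits the 4-query into the 2-queries {X + x + y, X + x' + y'} on the l-subsets of the 2n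
  vertices. With l^2 about n / k an edge meets O(d) others on average.

  Case n <= 4k. Then l = 1 and the Kikuchi graph is empty. Instead set about delta k / 2
  coordinates of the code to zero: each triple through one of them becomes a pair.

  The cut L need not be small: the bits outside L keep their place in the message and get empty
  matchings, so k2 = k3 = k.
*)
theory Submission
  imports Defs
begin

section \<open>Matchings, cuts and subset counts\<close>

text \<open>Each rate is the number of queries found, divided by the conflicts per query. Stars give
  about d \<delta> n k ordered pairs against O(d + k) conflicts. Light triples give about (\<delta>
  n k)^2 / n intersecting pairs; each becomes about (l / n)^2 N, that is N / (n k), edges, so about
  \<delta>^2 k N edges face O(d) conflicts. That O(d) dictates how a 4-query is split. Two 4-queries
  for the same bit that share x and y agree in the triple of x, leave two choices for w, and then
  the other triple contains the light pair of w and y. Splitting into x, x' and y, y' instead would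
  admit every second triple through w, up to k of them. Some edges meet many others, when X happens
  to contain vertices of further queries. Only the average is bounded; edges far above it are
  dropped before a maximal matching is chosen. The bound \<delta> k >= 2 makes pairs of distinct
  triples dominate the pairs (A, A).\<close>

lemma sum_card_swap:
  assumes "finite A" "finite B"
  shows "(\<Sum>a\<in>A. card {b\<in>B. R a b}) = (\<Sum>b\<in>B. card {a\<in>A. R a b})"
proof -
  have "(\<Sum>a\<in>A. card {b\<in>B. R a b}) = (\<Sum>a\<in>A. \<Sum>b\<in>B. if R a b then 1 else 0)"
    using assms by (simp add: sum.If_cases Int_def conj_commute)
  also have "\<dots> = (\<Sum>b\<in>B. \<Sum>a\<in>A. if R a b then 1 else 0)"
    by (rule sum.swap)
  also have "\<dots> = (\<Sum>b\<in>B. card {a\<in>A. R a b})"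
    using assms by (simp add: sum.If_cases Int_def conj_commute)
  finally show ?thesis .
qed

lemma card_eq_sum_fibers:
  assumes "finite Z" "\<And>z. z \<in> Z \<Longrightarrow> g z \<in> B" "finite B"
  shows "(\<Sum>i\<in>B. card {z\<in>Z. g z = i}) = card Z"
proof -
  have "{b \<in> B. g z = b} = {g z}" if "z \<in> Z" for z
    using assms(2)[OF that] by auto
  then show ?thesis
    using sum_card_swap[OF assms(1,3), of "\<lambda>z i. g z = i"] by simp
qed

text \<open>By Markov, at least half of the indices meet at most \<open>2 * D\<close> indices,
  themselves included. A maximal pairwise disjoint choice \<open>J\<close> among these is met by
  every one of them, so they number at most \<open>2 * D * card J\<close>. The family is indexed
  because distinct indices may carry equal sets; nonemptiness makes \<open>e\<close> injective on
  \<open>J\<close>.\<close>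

lemma matching_extraction:
  fixes e :: "'a \<Rightarrow> 'v set" and D :: real
  assumes fin: "finite I" and ne: "\<And>a. a \<in> I \<Longrightarrow> e a \<noteq> {}" and D: "D > 0"
    and conf: "(\<Sum>a\<in>I. real (card {b\<in>I. e a \<inter> e b \<noteq> {}})) \<le> D * real (card I)"
  obtains J where "J \<subseteq> I" "inj_on e J" "disjoint (e ` J)"
    "real (card I) \<le> 4 * D * real (card J)"
proof -
  define cnt where "cnt = (\<lambda>a. real (card {b\<in>I. e a \<inter> e b \<noteq> {}}))"
  define G where "G = {a\<in>I. cnt a \<le> 2 * D}"
  have finG: "finite G" and GI: "G \<subseteq> I" using fin by (auto simp: G_def)
  have "2 * D * real (card (I - G)) = (\<Sum>a\<in>I-G. 2 * D)" by simp
  also have "\<dots> \<le> (\<Sum>a\<in>I-G. cnt a)" by (rule sum_mono) (auto simp: G_def)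
  also have "\<dots> \<le> (\<Sum>a\<in>I. cnt a)" using fin by (intro sum_mono2) (auto simp: cnt_def)
  also have "\<dots> \<le> D * real (card I)" using conf by (simp add: cnt_def)
  finally have "2 * real (card (I - G)) \<le> real (card I)" using D by simp
  then have half: "real (card I) \<le> 2 * real (card G)"
    using GI fin by (simp add: card_Diff_subset finG card_mono of_nat_diff)
  define F where "F = {J. J \<subseteq> G \<and> (\<forall>a\<in>J. \<forall>b\<in>J. a \<noteq> b \<longrightarrow> e a \<inter> e b = {})}"
  have "finite F" "{} \<in> F" using finG by (auto simp: F_def)
  then obtain J where J: "J \<in> F" and maxJ: "\<And>J'. J' \<in> F \<Longrightarrow> J \<subseteq> J' \<Longrightarrow> J = J'"
    using finite_has_maximal[of F] by blast
  have JG: "J \<subseteq> G" and Jd: "\<And>a b. a \<in> J \<Longrightarrow> b \<in> J \<Longrightarrow> a \<noteq> b \<Longrightarrow> e a \<inter> e b = {}"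
    using J by (auto simp: F_def)
  have "G \<subseteq> (\<Union>a\<in>J. {b\<in>I. e a \<inter> e b \<noteq> {}})"
  proof
    fix b assume b: "b \<in> G"
    show "b \<in> (\<Union>a\<in>J. {b\<in>I. e a \<inter> e b \<noteq> {}})"
    proof (rule ccontr)
      assume n: "\<not> ?thesis"
      then have d: "e a \<inter> e b = {}" if "a \<in> J" for a using that b GI by auto
      have "insert b J \<in> F" using d b JG Jd by (auto simp: F_def)
      then have "b \<in> J" using maxJ[of "insert b J"] by blast
      then show False using d[of b] ne[of b] b GI by auto
    qed
  qed
  then have "card G \<le> (\<Sum>a\<in>J. card {b\<in>I. e a \<inter> e b \<noteq> {}})"
    using fin finite_subset[OF JG finG]
    by (intro order.trans[OF card_mono card_UN_le]) auto
  then have "real (card G) \<le> (\<Sum>a\<in>J. cnt a)"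
    unfolding cnt_def of_nat_sum[symmetric] by (simp only: of_nat_le_iff)
  also have "\<dots> \<le> (\<Sum>a\<in>J. 2 * D)" using JG by (intro sum_mono) (auto simp: G_def)
  finally have "real (card I) \<le> 4 * D * real (card J)" using half by (simp add: algebra_simps)
  moreover have "inj_on e J"
  proof (rule inj_onI, rule ccontr)
    fix a b assume "a \<in> J" "b \<in> J" "e a = e b" "a \<noteq> b"
    then show False using Jd[of a b] ne[of b] JG GI by auto
  qed
  moreover have "disjoint (e ` J)"
  proof (rule disjointI)
    fix X Y assume "X \<in> e ` J" "Y \<in> e ` J" "X \<noteq> Y"
    then show "X \<inter> Y = {}" using Jd by auto
  qed
  ultimately show ?thesis using that JG GI by blast
qed

lemma card_separating_subsets:
  assumes "i < k" "j < k" "i \<noteq> (j::nat)"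
  shows "4 * card {L \<in> Pow {..<k}. i \<in> L \<and> j \<notin> L} = 2 ^ k"
proof -
  have "bij_betw (insert i) (Pow ({..<k} - {i,j})) {L \<in> Pow {..<k}. i \<in> L \<and> j \<notin> L}"
    by (rule bij_betw_byWitness[where f' = "\<lambda>L. L - {i}"]) (use assms in auto)
  then have "card {L \<in> Pow {..<k}. i \<in> L \<and> j \<notin> L} = card (Pow ({..<k} - {i,j}))"
    by (simp add: bij_betw_same_card)
  also have "\<dots> = 2 ^ (k - 2)"
    using assms by (subst card_Pow) (auto simp: card_Diff_subset)
  finally have "card {L \<in> Pow {..<k}. i \<in> L \<and> j \<notin> L} = 2 ^ (k - 2)" .
  moreover have "k = (k - 2) + 2" using assms by linarith
  then obtain m where "k = m + 2" ..
  ultimately show ?thesis by simp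
qed

text \<open>For L uniform among the subsets of the k labels, two distinct labels are separated in
  the prescribed order with probability 1/4; some L does at least as well as the average. The order
  matters: the label in L keeps its message bit, the other bit is set to zero.\<close>

lemma exists_cut:
  fixes la lb :: "'z \<Rightarrow> nat"
  assumes fin: "finite Z" and la: "\<And>z. z \<in> Z \<Longrightarrow> la z < k" and lb: "\<And>z. z \<in> Z \<Longrightarrow> lb z < k"
    and neq: "\<And>z. z \<in> Z \<Longrightarrow> la z \<noteq> lb z"
  shows "\<exists>L. card Z \<le> 4 * card {z\<in>Z. la z \<in> L \<and> lb z \<notin> L}"
proof (rule ccontr)
  assume "\<not> ?thesis"
  then have less: "4 * card {z\<in>Z. la z \<in> L \<and> lb z \<notin> L} < card Z" for L
    by (simp add: not_le)
  have "(\<Sum>L\<in>Pow {..<k}. 4 * card {z\<in>Z. la z \<in> L \<and> lb z \<notin> L})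
      = 4 * (\<Sum>z\<in>Z. card {L\<in>Pow {..<k}. la z \<in> L \<and> lb z \<notin> L})"
    using sum_card_swap[OF fin, of "Pow {..<k}" "\<lambda>z L. la z \<in> L \<and> lb z \<notin> L"]
    by (simp add: sum_distrib_left)
  also have "\<dots> = (\<Sum>z\<in>Z. 2 ^ k)"
    unfolding sum_distrib_left
    by (intro sum.cong refl card_separating_subsets la lb neq)
  also have "\<dots> = (\<Sum>L\<in>Pow {..<k}. card Z)" by (simp add: card_Pow)
  finally show False
    using sum_strict_mono[of "Pow {..<k}" "\<lambda>L. 4 * card {z\<in>Z. la z \<in> L \<and> lb z \<notin> L}" "\<lambda>_. card Z"]
      less by auto
qed

text \<open>As long as some pair lies in \<open>s\<close> members of T, \<open>s\<close> of them are
  taken out as one group. Groups have exactly \<open>s\<close> members even if more contain the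
  pair, so that every triple has the same number of partners in its group.\<close>

lemma star_partition:
  fixes T :: "'a set set"
  assumes "finite T" "s > 0"
  shows "\<exists>\<G>. (\<forall>G\<in>\<G>. G \<subseteq> T \<and> card G = s \<and> (\<exists>p. card p = 2 \<and> (\<forall>A\<in>G. p \<subseteq> A))) \<and>
    disjoint \<G> \<and> (\<forall>p. card p = 2 \<longrightarrow> card {A \<in> T - \<Union>\<G>. p \<subseteq> A} < s)"
  using assms(1)
proof (induction T rule: finite_psubset_induct)
  case (psubset T)
  show ?case
  proof (cases "\<forall>p. card p = 2 \<longrightarrow> card {A \<in> T. p \<subseteq> A} < s")
    case True
    then show ?thesis by (intro exI[of _ "{}"]) auto
  next
    case False
    then obtain p where p: "card p = 2" "s \<le> card {A \<in> T. p \<subseteq> A}" by (auto simp: not_less)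
    obtain G where G: "G \<subseteq> {A \<in> T. p \<subseteq> A}" "card G = s"
      using obtain_subset_with_card_n[OF p(2)] by metis
    have "G \<noteq> {}" using G(2) assms(2) by auto
    then have "T - G \<subset> T" using G(1) by blast
    from psubset.IH[OF this] obtain \<G> where IH:
      "\<And>H. H \<in> \<G> \<Longrightarrow> H \<subseteq> T - G \<and> card H = s \<and> (\<exists>p. card p = 2 \<and> (\<forall>A\<in>H. p \<subseteq> A))"
      "disjoint \<G>" "\<forall>p. card p = 2 \<longrightarrow> card {A \<in> T - G - \<Union>\<G>. p \<subseteq> A} < s"
      by meson
    have "T - \<Union>(insert G \<G>) = T - G - \<Union>\<G>" by auto
    moreover have "disjoint (insert G \<G>)"
    proof -
      have "G \<inter> H = {}" if "H \<in> \<G>" for H using IH(1)[OF that] by blast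
      then show ?thesis using IH(2) unfolding disjoint_def by blast
    qed
    moreover have "\<forall>H\<in>insert G \<G>. H \<subseteq> T \<and> card H = s \<and> (\<exists>p. card p = 2 \<and> (\<forall>A\<in>H. p \<subseteq> A))"
      using IH(1) G p(1) by blast
    ultimately show ?thesis
      using IH(3) by (intro exI[of _ "insert G \<G>"]) simp
  qed
qed

section \<open>Subsets of fixed size: absorption identities and averaging\<close>

lemma card_subsets_containing:
  assumes "finite A" "y \<in> A"
  shows "card A * card {X. X \<subseteq> A \<and> card X = m \<and> y \<in> X} = m * (card A choose m)"
proof (cases m)
  case 0
  then have "{X. X \<subseteq> A \<and> card X = m \<and> y \<in> X} = {}"
    using assms finite_subset by fastforce
  then show ?thesis using 0 by (metis card.empty mult_is_0)
next
  case (Suc m')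
  have fX: "finite X" if "X \<subseteq> A" for X using that assms(1) finite_subset by blast
  have "bij_betw (insert y) {X. X \<subseteq> A - {y} \<and> card X = m'} {X. X \<subseteq> A \<and> card X = m \<and> y \<in> X}"
  proof (rule bij_betw_byWitness[where f' = "\<lambda>X. X - {y}"])
    show "insert y ` {X. X \<subseteq> A - {y} \<and> card X = m'} \<subseteq> {X. X \<subseteq> A \<and> card X = m \<and> y \<in> X}"
    proof clarify
      fix X assume X: "X \<subseteq> A - {y}" "m' = card X"
      then have "finite X" "y \<notin> X" using fX by auto
      then show "insert y X \<subseteq> A \<and> card (insert y X) = m \<and> y \<in> insert y X"
        using X assms Suc by auto
    qed
  qed (use assms Suc fX in auto)
  then have "card {X. X \<subseteq> A \<and> card X = m \<and> y \<in> X} = (card A - 1 choose m')"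
    using n_subsets[of "A - {y}" m'] assms by (simp add: bij_betw_same_card[symmetric])
  then show ?thesis
    using Suc times_binomial_minus1_eq[of m "card A"] by simp
qed

text \<open>Taking out x reduces this to the one-point count in \<open>A - {x}\<close>, followed by
  one more absorption. It is the probability that a random m-set contains two given points; with the
  denominators cleared it needs no condition on m.\<close>

lemma card_subsets_containing_two:
  assumes "finite A" "x \<in> A" "y \<in> A" "x \<noteq> y"
  shows "card A * (card A - 1) * card {X. X \<subseteq> A \<and> card X = m \<and> x \<in> X \<and> y \<in> X}
    = m * (m - 1) * (card A choose m)"
proof (cases m)
  case 0
  then have "{X. X \<subseteq> A \<and> card X = m \<and> x \<in> X \<and> y \<in> X} = {}"
    using assms finite_subset by fastforce
  then show ?thesis using 0 by (metis card.empty mult_is_0)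
next
  case (Suc m')
  have fX: "finite X" if "X \<subseteq> A" for X using that assms(1) finite_subset by blast
  have "bij_betw (insert x) {X. X \<subseteq> A - {x} \<and> card X = m' \<and> y \<in> X}
    {X. X \<subseteq> A \<and> card X = m \<and> x \<in> X \<and> y \<in> X}"
  proof (rule bij_betw_byWitness[where f' = "\<lambda>X. X - {x}"])
    show "insert x ` {X. X \<subseteq> A - {x} \<and> card X = m' \<and> y \<in> X}
        \<subseteq> {X. X \<subseteq> A \<and> card X = m \<and> x \<in> X \<and> y \<in> X}"
    proof clarify
      fix X assume X: "X \<subseteq> A - {x}" "m' = card X" "y \<in> X"
      then have "finite X" "x \<notin> X" using fX by auto
      then show "insert x X \<subseteq> A \<and> card (insert x X) = m \<and> x \<in> insert x X \<and> y \<in> insert x X"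
        using X assms Suc by auto
    qed
  qed (use assms Suc fX in auto)
  then have eq: "card {X. X \<subseteq> A - {x} \<and> card X = m' \<and> y \<in> X}
      = card {X. X \<subseteq> A \<and> card X = m \<and> x \<in> X \<and> y \<in> X}"
    by (rule bij_betw_same_card)
  have "(card A - 1) * card {X. X \<subseteq> A \<and> card X = m \<and> x \<in> X \<and> y \<in> X} = m' * (card A - 1 choose m')"
    using card_subsets_containing[of "A - {x}" y m'] assms eq by simp
  then have "card A * ((card A - 1) * card {X. X \<subseteq> A \<and> card X = m \<and> x \<in> X \<and> y \<in> X})
      = m' * (card A * (card A - 1 choose m'))"
    by (simp only: mult.left_commute)
  also have "card A * (card A - 1 choose m') = m * (card A choose m)"
    using Suc times_binomial_minus1_eq[of m "card A"] by simp
  finally show ?thesis using Suc by (simp add: algebra_simps)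
qed

text \<open>Each point of A lies in the same fraction \<open>m / card A\<close> of the m-subsets, so
  \<open>sum g B\<close> averages to that fraction of \<open>sum g A\<close>.\<close>

lemma exists_heavy_subset:
  fixes g :: "'a \<Rightarrow> nat"
  assumes fin: "finite A" and m: "m \<le> card A"
  shows "\<exists>B\<subseteq>A. card B = m \<and> m * sum g A \<le> card A * sum g B"
proof (rule ccontr)
  assume no: "\<not> ?thesis"
  have less: "card A * sum g B < m * sum g A" if "B \<subseteq> A" "card B = m" for B
    using no that by (auto simp: not_le)
  define S where "S = {B. B \<subseteq> A \<and> card B = m}"
  have finS: "finite S" and cS: "card S = card A choose m"
    using fin n_subsets[OF fin] by (auto simp: S_def)
  have neS: "S \<noteq> {}" using obtain_subset_with_card_n[OF m] by (auto simp: S_def)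
  have "(\<Sum>B\<in>S. sum g B) = (\<Sum>B\<in>S. \<Sum>v\<in>A. if v \<in> B then g v else 0)"
    using fin by (intro sum.cong refl sum.mono_neutral_cong_left) (auto simp: S_def)
  also have "\<dots> = (\<Sum>v\<in>A. g v * card {B\<in>S. v \<in> B})"
    using finS by (subst sum.swap) (simp add: sum.If_cases Int_def mult.commute)
  finally have "card A * (\<Sum>B\<in>S. sum g B) = (\<Sum>v\<in>A. g v * (card A * card {B\<in>S. v \<in> B}))"
    by (simp add: sum_distrib_left mult_ac)
  also have "\<dots> = (\<Sum>v\<in>A. g v * (m * card S))"
    unfolding cS using card_subsets_containing[OF fin, of _ m]
    by (intro sum.cong refl) (simp add: S_def conj_assoc)
  also have "\<dots> = (\<Sum>B\<in>S. m * sum g A)" by (simp add: sum_distrib_left[symmetric] sum_distrib_right[symmetric] mult_ac)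
  finally show False
    using sum_strict_mono[OF finS neS, of "\<lambda>B. card A * sum g B" "\<lambda>_. m * sum g A"] less
    by (simp add: S_def sum_distrib_left)
qed

section \<open>Linear codes from families of edges\<close>

text \<open>By default the simplifier rewrites addition of bits to \<open>XOR\<close>, out of reach of the
  laws of commutative rings.\<close>

declare add_bit_eq_xor [simp del] mult_bit_eq_and [simp del]

text \<open>Over the two-element field additivity is linearity, the only scalars being 0 and
  1.\<close>

definition additive_functional :: "nat \<Rightarrow> (bit vec \<Rightarrow> bit) \<Rightarrow> bool" where
  "additive_functional k g \<longleftrightarrow>
     (\<forall>x \<in> carrier_vec k. \<forall>y \<in> carrier_vec k. g (x + y) = g x + g y)"

lemma additive_functionalD:
  "additive_functional k g \<Longrightarrow> x \<in> carrier_vec k \<Longrightarrow> y \<in> carrier_vec k \<Longrightarrow> g (x + y) = g x + g y"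
  by (simp add: additive_functional_def)

lemma additive_functional_zero:
  assumes "additive_functional k g"
  shows "g (0\<^sub>v k) = 0"
  using additive_functionalD[OF assms, of "0\<^sub>v k" "0\<^sub>v k"] by simp

lemma additive_functional_sum:
  assumes "\<And>v. v \<in> U \<Longrightarrow> additive_functional k (f v)"
  shows "additive_functional k (\<lambda>b. \<Sum>v\<in>U. f v b)"
  unfolding additive_functional_def
proof (intro ballI)
  fix x y :: "bit vec" assume "x \<in> carrier_vec k" "y \<in> carrier_vec k"
  then have "(\<Sum>v\<in>U. f v (x + y)) = (\<Sum>v\<in>U. f v x + f v y)"
    using additive_functionalD[OF assms] by (intro sum.cong refl)
  then show "(\<Sum>v\<in>U. f v (x + y)) = (\<Sum>v\<in>U. f v x) + (\<Sum>v\<in>U. f v y)"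
    by (simp only: sum.distrib)
qed

lemma additive_functional_comp:
  assumes "additive_functional k g"
    and "\<And>x. x \<in> carrier_vec k \<Longrightarrow> \<phi> x \<in> carrier_vec k"
    and "\<And>x y. x \<in> carrier_vec k \<Longrightarrow> y \<in> carrier_vec k \<Longrightarrow> \<phi> (x + y) = \<phi> x + \<phi> y"
  shows "additive_functional k (\<lambda>b. g (\<phi> b))"
  using assms by (simp add: additive_functional_def)

text \<open>Every two-query code below is assembled here. Coordinates are named by an arbitrary
  finite set \<open>V\<close>, such as vertices or l-subsets, and then numbered. \<open>I i\<close>
  indexes candidate queries for bit i, with repetitions and overlaps allowed, and \<open>D\<close>
  bounds their average number of conflicts. The factor \<open>4 * D\<close> in \<open>total\<close>
  is the loss in extracting matchings.\<close>

lemma linear_wLDC_2_of_edges: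
  fixes s t :: "'a \<Rightarrow> 'v" and D \<delta> :: real
  assumes V: "finite V" "card V = N"
    and F: "\<And>v. v \<in> V \<Longrightarrow> additive_functional k (F v)"
    and finI: "\<And>i. i < k \<Longrightarrow> finite (I i)"
    and st: "\<And>i a. i < k \<Longrightarrow> a \<in> I i \<Longrightarrow> s a \<in> V \<and> t a \<in> V \<and> s a \<noteq> t a"
    and sum: "\<And>i a b. i < k \<Longrightarrow> a \<in> I i \<Longrightarrow> b \<in> carrier_vec k \<Longrightarrow> F (s a) b + F (t a) b = b $ i"
    and D: "D > 0"
    and conf: "\<And>i. i < k \<Longrightarrow>
      (\<Sum>a\<in>I i. real (card {b\<in>I i. {s a, t a} \<inter> {s b, t b} \<noteq> {}})) \<le> D * real (card (I i))"
    and total: "4 * D * (\<delta> * real N * real k) \<le> (\<Sum>i<k. real (card (I i)))"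
  shows "\<exists>C. linear_wLDC 2 \<delta> k N C"
proof -
  obtain h where "bij_betw h {0..<card V} V"
    using V(1) ex_bij_betw_nat_finite by blast
  then have h: "bij_betw h {..<N} V"
    using V(2) by (simp add: atLeast0LessThan)
  define h' where "h' = inv_into {..<N} h"
  have h': "h' v < N" "h (h' v) = v" if "v \<in> V" for v
    using that h bij_betw_inv_into_right[OF h that] bij_betwE[OF bij_betw_inv_into[OF h]]
    by (auto simp: h'_def)
  have inj: "inj_on h' V"
    using h'(2) by (rule inj_on_inverseI)
  define C where "C = (\<lambda>b. vec N (\<lambda>m. F (h m) b))"
  have Fh: "additive_functional k (F (h m))" if "m < N" for m
    using F bij_betwE[OF h] that by blast
  have lin: "linear_code k N C"
    unfolding linear_code_def
  proof (intro conjI ballI allI)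
    fix x y :: "bit vec" and c :: bit
    assume x: "x \<in> carrier_vec k"
    show "C x \<in> carrier_vec N" by (simp add: C_def)
    show "C (x + y) = C x + C y" if "y \<in> carrier_vec k"
      using additive_functionalD[OF Fh x that] by (intro eq_vecI) (auto simp: C_def)
    show "C (c \<cdot>\<^sub>v x) = c \<cdot>\<^sub>v C x"
    proof (cases "c = 0")
      case True
      then have "c \<cdot>\<^sub>v x = 0\<^sub>v k" using x by auto
      then show ?thesis
        using True additive_functional_zero[OF Fh] by (intro eq_vecI) (auto simp: C_def)
    next
      case False
      then have "c = 1" by simp
      then show ?thesis by simp
    qed
  qed
  have "\<forall>i\<in>{..<k}. \<exists>J. J \<subseteq> I i \<and> inj_on (\<lambda>a. {s a, t a}) J \<and> disjoint ((\<lambda>a. {s a, t a}) ` J) \<and>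
      real (card (I i)) \<le> 4 * D * real (card J)"
  proof
    fix i assume "i \<in> {..<k}"
    then have i: "i < k" by simp
    show "\<exists>J. J \<subseteq> I i \<and> inj_on (\<lambda>a. {s a, t a}) J \<and> disjoint ((\<lambda>a. {s a, t a}) ` J) \<and>
      real (card (I i)) \<le> 4 * D * real (card J)"
      by (rule matching_extraction[OF finI[OF i] _ D conf[OF i]]) auto
  qed
  from bchoice[OF this] obtain J where J: "\<And>i. i < k \<Longrightarrow> J i \<subseteq> I i \<and> inj_on (\<lambda>a. {s a, t a}) (J i) \<and>
      disjoint ((\<lambda>a. {s a, t a}) ` J i) \<and> real (card (I i)) \<le> 4 * D * real (card (J i))"
    by auto
  define H where "H = (\<lambda>i. (`) h' ` (\<lambda>a. {s a, t a}) ` J i)"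
  have "hypergraph_on {..<N} (H i) \<and> uniform_hypergraph 2 (H i) \<and> hypergraph_matching (H i)
      \<and> card (H i) = card (J i)" if i: "i < k" for i
  proof (intro conjI)
    have JI: "J i \<subseteq> I i" using J[OF i] by blast
    have subV: "(\<lambda>a. {s a, t a}) ` J i \<subseteq> Pow V" using JI st[OF i] by blast
    show "hypergraph_on {..<N} (H i)"
      unfolding hypergraph_on_def H_def using h'(1) subV by blast
    show "uniform_hypergraph 2 (H i)"
      unfolding uniform_hypergraph_def H_def
    proof clarify
      fix a assume "a \<in> J i"
      then have "s a \<in> V" "t a \<in> V" "s a \<noteq> t a" using JI st[OF i] by auto
      then show "card (h' ` {s a, t a}) = 2"
        using inj_onD[OF inj, of "s a" "t a"] by (auto simp: card_insert_if)
    qed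
    show "hypergraph_matching (H i)"
      unfolding hypergraph_matching_def H_def
    proof (rule disjointI)
      fix X Y assume XY: "X \<in> (`) h' ` (\<lambda>a. {s a, t a}) ` J i" "Y \<in> (`) h' ` (\<lambda>a. {s a, t a}) ` J i"
        "X \<noteq> Y"
      obtain X' where X': "X = h' ` X'" "X' \<in> (\<lambda>a. {s a, t a}) ` J i"
        using XY(1) by (rule imageE)
      obtain Y' where Y': "Y = h' ` Y'" "Y' \<in> (\<lambda>a. {s a, t a}) ` J i"
        using XY(2) by (rule imageE)
      have "disjoint ((\<lambda>a. {s a, t a}) ` J i)" using J[OF i] by blast
      moreover have "X' \<noteq> Y'" using X'(1) Y'(1) XY(3) by blast
      ultimately have "X' \<inter> Y' = {}" using X'(2) Y'(2) by (meson disjointD)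
      then show "X \<inter> Y = {}"
        using X' Y' subV inj_on_image_Int[OF inj, of X' Y'] by auto
    qed
    have "inj_on ((`) h') ((\<lambda>a. {s a, t a}) ` J i)"
      using inj_on_image_Pow[OF inj] subV inj_on_subset by blast
    then show "card (H i) = card (J i)"
      unfolding H_def using J[OF i] by (simp add: card_image)
  qed
  note HH = this
  have "4 * D * (\<delta> * real N * real k) \<le> (\<Sum>i<k. 4 * D * real (card (H i)))"
    using J HH by (intro order.trans[OF total sum_mono]) auto
  also have "\<dots> = 4 * D * real (\<Sum>i<k. card (H i))"
    by (simp add: sum_distrib_left)
  finally have "\<delta> * real N * real k \<le> real (\<Sum>i<k. card (H i))"
    using D by (simp only: mult_le_cancel_left_pos mult_pos_pos zero_less_numeral)
  moreover have "(\<Sum>v\<in>e. C b $ v) = b $ i" if i: "i < k" "e \<in> H i" "b \<in> carrier_vec k" for i e b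
  proof -
    obtain a where a: "a \<in> J i" "e = h' ` {s a, t a}" using i(2) by (auto simp: H_def)
    then have aI: "a \<in> I i" using J[OF i(1)] by blast
    note sta = st[OF i(1) aI]
    have "h' (s a) \<noteq> h' (t a)" using inj_onD[OF inj] sta by blast
    then have "(\<Sum>v\<in>e. C b $ v) = F (s a) b + F (t a) b"
      using a(2) h' sta by (simp add: C_def)
    then show ?thesis using sum[OF i(1) aI i(3)] by simp
  qed
  ultimately show ?thesis
    unfolding linear_wLDC_def using lin HH by (intro exI[of _ C] conjI exI[of _ H]) simp_all
qed

text \<open>Elimination, one functional at a time: a functional that is not yet zero is killed at
  the cost of one message bit, which goes into \<open>Bad\<close>. Since \<phi> is additive, a
  linear code precomposed with it stays linear and still decodes every bit outside
  \<open>Bad\<close>.\<close>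

lemma exists_vanishing_subspace:
  fixes f :: "'v \<Rightarrow> bit vec \<Rightarrow> bit"
  assumes "finite V" "\<forall>v\<in>V. additive_functional k (f v)"
  shows "\<exists>\<phi> Bad. finite Bad \<and> card Bad \<le> card V \<and>
    (\<forall>x\<in>carrier_vec k. \<phi> x \<in> carrier_vec k \<and> (\<forall>i<k. i \<notin> Bad \<longrightarrow> \<phi> x $ i = x $ i) \<and>
       (\<forall>v\<in>V. f v (\<phi> x) = 0)) \<and>
    (\<forall>x\<in>carrier_vec k. \<forall>y\<in>carrier_vec k. \<phi> (x + y) = \<phi> x + \<phi> y)"
  using assms
proof (induction V rule: finite_induct)
  case empty
  then show ?case by (intro exI[of _ "\<lambda>x. x"] exI[of _ "{}"]) auto
next
  case (insert v V)
  have "\<forall>u\<in>V. additive_functional k (f u)" using insert.prems by blast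
  from insert.IH[OF this] obtain \<phi> Bad where B: "finite Bad" "card Bad \<le> card V"
    and \<phi>': "\<forall>x\<in>carrier_vec k. \<phi> x \<in> carrier_vec k \<and>
        (\<forall>i<k. i \<notin> Bad \<longrightarrow> \<phi> x $ i = x $ i) \<and> (\<forall>v\<in>V. f v (\<phi> x) = 0)"
      "\<forall>x\<in>carrier_vec k. \<forall>y\<in>carrier_vec k. \<phi> (x + y) = \<phi> x + \<phi> y"
    by (elim exE conjE) (rule that)
  have \<phi>: "\<And>x. x \<in> carrier_vec k \<Longrightarrow> \<phi> x \<in> carrier_vec k"
      "\<And>x i. x \<in> carrier_vec k \<Longrightarrow> i < k \<Longrightarrow> i \<notin> Bad \<Longrightarrow> \<phi> x $ i = x $ i"
      "\<And>x u. x \<in> carrier_vec k \<Longrightarrow> u \<in> V \<Longrightarrow> f u (\<phi> x) = 0"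
      "\<And>x y. x \<in> carrier_vec k \<Longrightarrow> y \<in> carrier_vec k \<Longrightarrow> \<phi> (x + y) = \<phi> x + \<phi> y"
    using \<phi>' by simp_all
  \<comment> \<open>The new functional is read after \<phi>, and its correction \<psi> will be
    applied before \<phi>; hence the functionals killed earlier stay zero.\<close>
  define g where "g = (\<lambda>x. f v (\<phi> x))"
  have "additive_functional k (f v)" using insert.prems by blast
  from additive_functional_comp[OF this \<phi>(1,4)] have g: "additive_functional k g"
    by (simp add: g_def)
  show ?case
  proof (cases "\<forall>x\<in>carrier_vec k. g x = 0")
    case True
    then show ?thesis
      using B \<phi> insert.hyps
      by (intro exI[of _ \<phi>] exI[of _ Bad]) (auto simp: g_def)
  next
    case False
    \<comment> \<open>Otherwise g vanishes everywhere, by induction on the number of nonzero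
      coordinates: adding a unit vector clears one of them and leaves g unchanged.\<close>
    have "\<exists>j<k. g (unit_vec k j) = 1"
    proof (rule ccontr)
      assume "\<not> ?thesis"
      then have unit: "g (unit_vec k j) = 0" if "j < k" for j
        using that by (metis bit_not_one_iff)
      have "g x = 0" if "x \<in> carrier_vec k" for x
        using that
      proof (induction "card {j. j < k \<and> x $ j \<noteq> 0}" arbitrary: x)
        case 0
        then have "x = 0\<^sub>v k" by (intro eq_vecI) auto
        then show ?case using additive_functional_zero[OF g] by simp
      next
        case (Suc m)
        then obtain j where j: "j < k" "x $ j \<noteq> 0"
          by (metis (mono_tags, lifting) card.empty empty_Collect_eq nat.distinct(1))
        define y where "y = x + unit_vec k j"
        have y: "y \<in> carrier_vec k" using Suc.prems by (simp add: y_def)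
        have "{l. l < k \<and> y $ l \<noteq> 0} = {l. l < k \<and> x $ l \<noteq> 0} - {j}"
          using j Suc.prems by (auto simp: y_def split: if_splits)
        then have "m = card {l. l < k \<and> y $ l \<noteq> 0}"
          using j Suc.hyps(2) by simp
        then have "g y = 0" using Suc.hyps(1) y by blast
        then show ?case
          using additive_functionalD[OF g Suc.prems, of "unit_vec k j"] unit[OF j(1)]
          by (simp add: y_def)
      qed
      then show False using False by blast
    qed
    then obtain j where j: "j < k" "g (unit_vec k j) = 1" by blast
    \<comment> \<open>Flips bit j exactly when \<open>g x = 1\<close>. As g is 1 on the j-th unit
      vector, the result lies in the kernel of g.\<close>
    define \<psi> where "\<psi> = (\<lambda>x. x + g x \<cdot>\<^sub>v unit_vec k j)"
    have \<psi>c: "\<psi> x \<in> carrier_vec k" if "x \<in> carrier_vec k" for x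
      using that by (simp add: \<psi>_def)
    have \<psi>add: "\<psi> (x + y) = \<psi> x + \<psi> y" if "x \<in> carrier_vec k" "y \<in> carrier_vec k" for x y
      using that additive_functionalD[OF g that]
      by (intro eq_vecI) (auto simp: \<psi>_def algebra_simps)
    have \<psi>i: "\<psi> x $ i = x $ i" if "x \<in> carrier_vec k" "i < k" "i \<noteq> j" for x i
      using that j by (simp add: \<psi>_def)
    have g\<psi>: "g (\<psi> x) = 0" if x: "x \<in> carrier_vec k" for x
    proof (cases "g x = 0")
      case True
      then have "\<psi> x = x" using x by (intro eq_vecI) (auto simp: \<psi>_def)
      then show ?thesis using True by simp
    next
      case False
      then have "g x = 1" by simp
      then show ?thesis
        using additive_functionalD[OF g x, of "unit_vec k j"] j(2) by (simp add: \<psi>_def)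
    qed
    show ?thesis
    proof (intro exI[of _ "\<lambda>x. \<phi> (\<psi> x)"] exI[of _ "insert j Bad"] conjI ballI allI impI)
      show "finite (insert j Bad)" using B by simp
      show "card (insert j Bad) \<le> card (insert v V)"
        using B insert.hyps by (simp add: card_insert_if)
    next
      fix x y :: "bit vec" assume x: "x \<in> carrier_vec k"
      show "\<phi> (\<psi> x) \<in> carrier_vec k" using \<phi>(1) \<psi>c x by blast
      show "\<phi> (\<psi> x) $ i = x $ i" if "i < k" "i \<notin> insert j Bad" for i
        using \<phi>(2)[OF \<psi>c[OF x]] \<psi>i[OF x] that by auto
      show "f u (\<phi> (\<psi> x)) = 0" if "u \<in> insert v V" for u
        using that \<phi>(3)[OF \<psi>c[OF x]] g\<psi>[OF x] by (auto simp: g_def)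
      show "\<phi> (\<psi> (x + y)) = \<phi> (\<psi> x) + \<phi> (\<psi> y)" if "y \<in> carrier_vec k"
        using x that by (simp add: \<psi>add \<psi>c \<phi>(4))
    qed
  qed
qed

text \<open>Minimum and maximum serve as a canonical way to tell the two vertices of a pair
  apart.\<close>

lemma card_2_Min_Max:
  fixes P :: "nat set"
  assumes "card P = 2"
  shows "Min P \<in> P" "Max P \<in> P" "Min P \<noteq> Max P" "P = {Min P, Max P}"
proof -
  obtain x y where "P = {x, y}" "x \<noteq> y" using assms by (metis card_2_iff)
  then show "Min P \<in> P" "Max P \<in> P" "Min P \<noteq> Max P" "P = {Min P, Max P}"
    by (auto simp: min_def max_def)
qed

section \<open>Labelled triples\<close>

text \<open>A single label per triple suffices, since a triple decoding two bits would force them to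
  agree in every message. \<open>lab_disjoint\<close> is the matching property of each label class,
  and \<open>f v\<close> computes coordinate v of the codeword.\<close>

locale labelled_triples =
  fixes k n :: nat and T :: "nat set set" and lab :: "nat set \<Rightarrow> nat"
    and f :: "nat \<Rightarrow> bit vec \<Rightarrow> bit"
  assumes T_sub: "A \<in> T \<Longrightarrow> A \<subseteq> {..<n}"
    and T_card: "A \<in> T \<Longrightarrow> card A = 3"
    and lab_less: "A \<in> T \<Longrightarrow> lab A < k"
    and lab_disjoint: "A \<in> T \<Longrightarrow> B \<in> T \<Longrightarrow> lab A = lab B \<Longrightarrow> v \<in> A \<Longrightarrow> v \<in> B \<Longrightarrow> A = B"
    and f_additive: "v < n \<Longrightarrow> additive_functional k (f v)"
    and f_sum: "A \<in> T \<Longrightarrow> b \<in> carrier_vec k \<Longrightarrow> (\<Sum>v\<in>A. f v b) = b $ lab A"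
begin

lemma finite_T: "finite T"
  using T_sub by (intro finite_subset[of T "Pow {..<n}"]) auto

lemma finite_triple: "A \<in> T \<Longrightarrow> finite A"
  using T_card card.infinite by fastforce

lemma card_star_le: "card {A \<in> T. v \<in> A} \<le> k"
proof -
  have "card {A \<in> T. v \<in> A} \<le> card {..<k}"
    using lab_less lab_disjoint by (intro card_inj_on_le[where f = lab]) (auto simp: inj_on_def)
  then show ?thesis by simp
qed

lemma card_label_vertex_le: "card {A \<in> T. lab A = i \<and> v \<in> A} \<le> 1"
proof -
  have "card {A \<in> T. lab A = i \<and> v \<in> A} \<le> card {()}"
    using lab_disjoint by (intro card_inj_on_le[where f = "\<lambda>_. ()"]) (auto simp: inj_on_def)
  then show ?thesis by simp
qed

text \<open>If \<open>n\<close> is at most a constant times \<open>k\<close>, zeroing about \<open>\<delta>k/2\<close> coordinates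
  already turns enough triples into pairs.\<close>

lemma wLDC_2_of_vanishing:
  assumes t: "t \<le> n" and V: "finite V" "card V = N" "{..<n} \<subseteq> V"
    and total: "4 * (\<delta> * real N * real k) \<le> real t * real (card T) / real n - real t ^ 2"
  shows "\<exists>C. linear_wLDC 2 \<delta> k N C"
proof -
  \<comment> \<open>Each triple is charged to its least vertex only, so it is counted once, and the
    query left after zeroing that vertex is \<open>A - {Min A}\<close>.\<close>
  define g where "g = (\<lambda>v. card {A\<in>T. Min A = v})"
  obtain V0 where V0: "V0 \<subseteq> {..<n}" "card V0 = t" "t * sum g {..<n} \<le> n * sum g V0"
    using exists_heavy_subset[of "{..<n}" t g] t by auto
  have finV0: "finite V0" using V0(1) finite_subset by blast
  have MinT: "Min A \<in> A" if "A \<in> T" for A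
    using that T_card finite_triple by (intro Min_in) fastforce+
  have "sum g {..<n} = card T"
    unfolding g_def using MinT T_sub by (intro card_eq_sum_fibers finite_T) auto
  have "sum g V0 = card {A\<in>T. Min A \<in> V0}"
  proof -
    have "sum g V0 = (\<Sum>v\<in>V0. card {A \<in> {A\<in>T. Min A \<in> V0}. Min A = v})"
      unfolding g_def by (intro sum.cong refl arg_cong[where f = card]) auto
    also have "\<dots> = card {A\<in>T. Min A \<in> V0}"
      by (rule card_eq_sum_fibers) (auto simp: finite_T finV0)
    finally show ?thesis .
  qed
  have "\<forall>v\<in>V0. additive_functional k (f v)" using f_additive V0(1) by auto
  from exists_vanishing_subspace[OF finV0 this]
  obtain \<phi> Bad where B: "finite Bad" "card Bad \<le> t"
    and \<phi>': "\<forall>x\<in>carrier_vec k. \<phi> x \<in> carrier_vec k \<and>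
        (\<forall>i<k. i \<notin> Bad \<longrightarrow> \<phi> x $ i = x $ i) \<and> (\<forall>v\<in>V0. f v (\<phi> x) = 0)"
      "\<forall>x\<in>carrier_vec k. \<forall>y\<in>carrier_vec k. \<phi> (x + y) = \<phi> x + \<phi> y"
    unfolding V0(2) by (elim exE conjE) (rule that)
  define X where "X = {A\<in>T. Min A \<in> V0}"
  have finX: "finite X" using finite_T by (simp add: X_def)
  define I where "I = (\<lambda>i. {A\<in>X. lab A = i \<and> i \<notin> Bad})"
  define s where "s = (\<lambda>A::nat set. Min (A - {Min A}))"
  define u where "u = (\<lambda>A::nat set. Max (A - {Min A}))"
  have su: "s A \<in> A" "u A \<in> A" "s A \<noteq> u A" "A = {Min A, s A, u A}" "Min A \<noteq> s A" "Min A \<noteq> u A"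
    if "A \<in> T" for A
  proof -
    have c: "card (A - {Min A}) = 2"
      using that T_card MinT finite_triple by simp
    note m = card_2_Min_Max[OF c]
    show "s A \<in> A" "u A \<in> A" "s A \<noteq> u A" "Min A \<noteq> s A" "Min A \<noteq> u A"
      using m unfolding s_def u_def by auto
    show "A = {Min A, s A, u A}"
      using m(4) MinT[OF that] unfolding s_def u_def by blast
  qed
  \<comment> \<open>\<open>V\<close> may exceed the n original coordinates; the additional ones are
    constantly zero.\<close>
  define F where "F = (\<lambda>v b. if v < n then f v (\<phi> b) else 0)"
  show ?thesis
  proof (rule linear_wLDC_2_of_edges[where I = I and s = s and t = u and F = F and D = 1, OF V(1,2)])
    fix v assume "v \<in> V"
    show "additive_functional k (F v)"
    proof (cases "v < n")
      case True
      then show ?thesis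
        using additive_functional_comp[OF f_additive[OF True], of \<phi>] \<phi>' by (simp add: F_def)
    next
      case False
      then show ?thesis by (simp add: F_def additive_functional_def)
    qed
  next
    fix i assume i: "i < k"
    show "finite (I i)" using finX by (simp add: I_def)
    show "s A \<in> V \<and> u A \<in> V \<and> s A \<noteq> u A" if "A \<in> I i" for A
    proof -
      have "A \<in> T" using that by (auto simp: I_def X_def)
      then show ?thesis using su[of A] T_sub[of A] V(3) by blast
    qed
    show "F (s A) b + F (u A) b = b $ i" if A: "A \<in> I i" and b: "b \<in> carrier_vec k" for A b
    proof -
      have AT: "A \<in> T" "Min A \<in> V0" "lab A = i" "i \<notin> Bad" using A by (auto simp: I_def X_def)
      have lt: "s A < n" "u A < n" using su(1,2)[OF AT(1)] T_sub[OF AT(1)] by auto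
      have "(\<Sum>v\<in>A. f v (\<phi> b)) = (\<Sum>v\<in>{Min A, s A, u A}. f v (\<phi> b))"
        using su(4)[OF AT(1)] by (rule arg_cong)
      also have "\<dots> = f (Min A) (\<phi> b) + (f (s A) (\<phi> b) + f (u A) (\<phi> b))"
        using su(3,5,6)[OF AT(1)] by simp
      finally have "f (Min A) (\<phi> b) + (f (s A) (\<phi> b) + f (u A) (\<phi> b)) = b $ i"
        using f_sum[OF AT(1), of "\<phi> b"] \<phi>' b AT i by simp
      then show ?thesis using \<phi>' b AT(2) lt by (simp add: F_def)
    qed
    \<comment> \<open>Queries for one bit inherit disjointness from their triples, so each conflicts
      only with itself and D = 1 suffices.\<close>
    have sub: "{B\<in>I i. {s A, u A} \<inter> {s B, u B} \<noteq> {}} \<subseteq> {A}" if "A \<in> I i" for A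
    proof
      fix B assume "B \<in> {B\<in>I i. {s A, u A} \<inter> {s B, u B} \<noteq> {}}"
      then have B: "B \<in> T" "lab B = i" and "{s A, u A} \<inter> {s B, u B} \<noteq> {}"
        by (auto simp: I_def X_def)
      then obtain v where "v \<in> {s A, u A}" "v \<in> {s B, u B}" by blast
      moreover have A: "A \<in> T" "lab A = i" using that by (auto simp: I_def X_def)
      ultimately have "v \<in> A" "v \<in> B" using su(1,2)[OF A(1)] su(1,2)[OF B(1)] by auto
      then have "A = B" using lab_disjoint[OF A(1) B(1)] A(2) B(2) by simp
      then show "B \<in> {A}" by simp
    qed
    have "card {B\<in>I i. {s A, u A} \<inter> {s B, u B} \<noteq> {}} \<le> 1" if "A \<in> I i" for A
      using card_mono[OF _ sub[OF that]] by simp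
    then have "(\<Sum>A\<in>I i. real (card {B\<in>I i. {s A, u A} \<inter> {s B, u B} \<noteq> {}})) \<le> (\<Sum>A\<in>I i. 1)"
      by (intro sum_mono) simp
    then show "(\<Sum>A\<in>I i. real (card {B\<in>I i. {s A, u A} \<inter> {s B, u B} \<noteq> {}})) \<le> 1 * real (card (I i))"
      by simp
  next
    have "real t * real (card T) \<le> real n * real (card X)"
    proof -
      have "t * card T \<le> n * card X"
        using V0(3) \<open>sum g {..<n} = card T\<close> \<open>sum g V0 = _\<close> by (simp add: X_def)
      then show ?thesis by (simp only: of_nat_mult[symmetric] of_nat_le_iff)
    qed
    then have tX: "real t * real (card T) / real n \<le> real (card X)"
      by (cases "n = 0") (auto simp: field_simps)
    \<comment> \<open>Triples of one label have distinct least vertices, so at most t of them have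
      it in \<open>V0\<close>. With at most t labels in \<open>Bad\<close>, dropping those labels
      costs at most \<open>t ^ 2\<close> triples.\<close>
    have "card {A\<in>X. lab A = i} \<le> t" for i
    proof -
      have "inj_on Min {A\<in>X. lab A = i}"
        using MinT lab_disjoint unfolding X_def
        by (intro inj_onI) (metis (mono_tags, lifting) mem_Collect_eq)
      then have "card {A\<in>X. lab A = i} \<le> card V0"
        by (rule card_inj_on_le) (auto simp: X_def finV0)
      then show ?thesis using V0(2) by simp
    qed
    then have "(\<Sum>i\<in>Bad. card {A\<in>X. lab A = i}) \<le> (\<Sum>i\<in>Bad. t)" by (intro sum_mono)
    also have "\<dots> \<le> t ^ 2" using B by (simp add: power2_eq_square)
    finally have bad: "(\<Sum>i\<in>Bad. card {A\<in>X. lab A = i}) \<le> t ^ 2" .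
    have "card X = (\<Sum>i<k. card {A\<in>X. lab A = i})"
      using card_eq_sum_fibers[of X lab "{..<k}"] lab_less finX by (simp add: X_def)
    also have "\<dots> \<le> (\<Sum>i<k. card (I i) + (if i \<in> Bad then card {A\<in>X. lab A = i} else 0))"
      by (intro sum_mono) (auto simp: I_def)
    also have "\<dots> = (\<Sum>i<k. card (I i)) + (\<Sum>i\<in>{..<k} \<inter> Bad. card {A\<in>X. lab A = i})"
      by (simp add: sum.distrib sum.If_cases)
    also have "(\<Sum>i\<in>{..<k} \<inter> Bad. card {A\<in>X. lab A = i}) \<le> (\<Sum>i\<in>Bad. card {A\<in>X. lab A = i})"
      using B by (intro sum_mono2) auto
    finally have "card X \<le> (\<Sum>i<k. card (I i)) + t ^ 2" using bad by linarith
    then have "real (card X) \<le> (\<Sum>i<k. real (card (I i))) + real t ^ 2"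
      by (simp only: of_nat_add[symmetric] of_nat_power[symmetric] of_nat_sum[symmetric] of_nat_le_iff)
    then show "4 * 1 * (\<delta> * real N * real k) \<le> (\<Sum>i<k. real (card (I i)))"
      using tX total by simp
  qed simp
qed

end

section \<open>Triples sharing a common pair\<close>

definition restrict_msg :: "nat \<Rightarrow> nat set \<Rightarrow> bit vec \<Rightarrow> bit vec" where
  "restrict_msg k L b = vec k (\<lambda>i. if i \<in> L then b $ i else 0)"

lemma restrict_msg_carrier [simp]: "restrict_msg k L b \<in> carrier_vec k"
  by (simp add: restrict_msg_def)

lemma restrict_msg_index [simp]: "i < k \<Longrightarrow> restrict_msg k L b $ i = (if i \<in> L then b $ i else 0)"
  by (simp add: restrict_msg_def)

lemma additive_functional_restrict:
  assumes "additive_functional k g"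
  shows "additive_functional k (\<lambda>b. g (restrict_msg k L b))"
  by (rule additive_functional_comp[OF assms]) (auto intro!: eq_vecI simp: restrict_msg_def)

lemma bit_add_self [simp]: "a + a = (0::bit)"
  using bit_2_eq_0 mult_2[of a] by simp

text \<open>Distinct triples of one group share exactly two vertices; hence their labels differ and
  each has one private vertex, which becomes an end of the query. The constant 32 is 4 for the cut,
  times 4 for the extraction, times 2 from the conflict bound \<open>2 * (d + k)\<close>.\<close>

lemma (in labelled_triples) wLDC_2_of_stars:
  assumes \<G>: "\<And>G. G \<in> \<G> \<Longrightarrow> G \<subseteq> T \<and> card G = d + 1 \<and> (\<exists>p. card p = 2 \<and> (\<forall>A\<in>G. p \<subseteq> A))"
    and disj: "disjoint \<G>" and d: "d > 0"
    and total: "32 * (real d + real k) * (\<delta> * real n * real k) \<le> real (card (\<Union>\<G>)) * real d"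
  shows "\<exists>C. linear_wLDC 2 \<delta> k n C"
proof -
  define Z where "Z = {(A, B). \<exists>G\<in>\<G>. A \<in> G \<and> B \<in> G \<and> A \<noteq> B}"
  define s where "s = (\<lambda>(A::nat set, B). the_elem (A - B))"
  define t where "t = (\<lambda>(A::nat set, B). the_elem (B - A))"
  have ZT: "A \<in> T" "B \<in> T" "A \<noteq> B" "A \<in> \<Union>\<G>" if "(A, B) \<in> Z" for A B
    using that \<G> by (auto simp: Z_def)
  have Zfin: "finite Z"
    using ZT by (intro finite_subset[OF _ finite_cartesian_product[OF finite_T finite_T]]) auto
  have Zsym: "(B, A) \<in> Z" if "(A, B) \<in> Z" for A B
    using that by (auto simp: Z_def)
  have Zcard: "card (A \<inter> B) \<ge> 2" if z: "(A, B) \<in> Z" for A B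
  proof -
    obtain G where "G \<in> \<G>" "A \<in> G" "B \<in> G" using z by (auto simp: Z_def)
    then obtain p where "card p = 2" "p \<subseteq> A" "p \<subseteq> B" using \<G> by meson
    then show ?thesis
      using card_mono[of "A \<inter> B" p] finite_triple[OF ZT(1)[OF z]] by auto
  qed
  have Zlab: "lab A \<noteq> lab B" if z: "(A, B) \<in> Z" for A B
  proof
    assume "lab A = lab B"
    moreover have "A \<inter> B \<noteq> {}" using Zcard[OF z] by auto
    ultimately show False using lab_disjoint ZT[OF z] by blast
  qed
  have diff: "\<exists>x. A - B = {x}" if z: "(A, B) \<in> Z" for A B
  proof -
    note fin = finite_triple[OF ZT(1)[OF z]] finite_triple[OF ZT(2)[OF z]]
    have "card (A - B) = 3 - card (A \<inter> B)"
      using fin T_card[OF ZT(1)[OF z]] by (simp add: card_Diff_subset_Int)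
    moreover have "A - B \<noteq> {}"
      using card_subset_eq[OF fin(2), of A] ZT(3)[OF z] T_card ZT(1,2)[OF z] by auto
    ultimately have "card (A - B) = 1"
      using Zcard[OF z] fin by (metis One_nat_def Suc_leI card_gt_0_iff diff_le_mono2 finite_Diff
        le_antisym numeral_2_eq_2 numeral_3_eq_3 diff_Suc_Suc diff_zero)
    then show ?thesis by (rule card_1_singletonE) blast
  qed
  have s: "A - B = {s (A, B)}" if "(A, B) \<in> Z" for A B
    unfolding s_def prod.case using diff[OF that] by (elim exE) (simp only: the_elem_eq)
  have t: "B - A = {t (A, B)}" if "(A, B) \<in> Z" for A B
    unfolding t_def prod.case using diff[OF Zsym[OF that]] by (elim exE) (simp only: the_elem_eq)
  have nbrs: "card {B. (A, B) \<in> Z} = d" if A: "A \<in> \<Union>\<G>" for A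
  proof -
    obtain G where G: "G \<in> \<G>" "A \<in> G" using A by blast
    have "{B. (A, B) \<in> Z} = G - {A}"
      using G disj unfolding Z_def disjoint_def by blast
    then show ?thesis using \<G>[OF G(1)] G(2) by simp
  qed
  have "Z = (SIGMA A:\<Union>\<G>. {B. (A, B) \<in> Z})"
    using ZT(4) by auto
  moreover have fin_nbrs: "finite {B. (A, B) \<in> Z}" for A
    by (rule finite_subset[OF _ finite_T]) (auto simp: ZT)
  moreover have "finite (\<Union>\<G>)" using \<G> finite_T by (intro finite_subset[of "\<Union>\<G>" T]) auto
  ultimately have cardZ: "card Z = card (\<Union>\<G>) * d"
    using card_SigmaI[of "\<Union>\<G>" "\<lambda>A. {B. (A, B) \<in> Z}"] nbrs by simp
  obtain L where L: "card Z \<le> 4 * card {z\<in>Z. lab (fst z) \<in> L \<and> lab (snd z) \<notin> L}"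
    using exists_cut[of Z "\<lambda>z. lab (fst z)" k "\<lambda>z. lab (snd z)"] Zfin Zlab ZT lab_less by fastforce
  define I where "I = (\<lambda>i. {z \<in> {z\<in>Z. lab (fst z) \<in> L \<and> lab (snd z) \<notin> L}. lab (fst z) = i})"
  have finI: "finite (I i)" for i using Zfin by (simp add: I_def)
  define N where "N = (\<lambda>i u. {z\<in>I i. s z = u \<or> t z = u})"
  \<comment> \<open>If u is the end in the first triple A, then u and the label i determine A, which
    has at most d partners. If u is the end in the second triple B, there are at most k such B, and
    each determines A.\<close>
  have cardN: "card (N i u) \<le> d + k" for i u
  proof -
    let ?S = "{A\<in>T. lab A = i \<and> u \<in> A}"
    have "{z\<in>I i. s z = u} \<subseteq> (SIGMA A:?S. {B. (A, B) \<in> Z})"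
      using s ZT by (fastforce simp: I_def)
    then have "card {z\<in>I i. s z = u} \<le> card (SIGMA A:?S. {B. (A, B) \<in> Z})"
      using finite_T fin_nbrs by (intro card_mono) auto
    also have "\<dots> = (\<Sum>A\<in>?S. card {B. (A, B) \<in> Z})"
      using finite_T fin_nbrs by (intro card_SigmaI) auto
    also have "\<dots> \<le> (\<Sum>A\<in>?S. d)"
    proof (rule sum_mono)
      fix A
      show "card {B. (A, B) \<in> Z} \<le> d"
      proof (cases "A \<in> \<Union>\<G>")
        case False
        then have "{B. (A, B) \<in> Z} = {}" using ZT(4) by blast
        then show ?thesis by simp
      qed (simp only: nbrs order.refl)
    qed
    also have "\<dots> \<le> d"
      using card_label_vertex_le[of i u] by simp
    finally have 1: "card {z\<in>I i. s z = u} \<le> d" .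
    have "inj_on snd {z\<in>I i. t z = u}"
    proof (rule inj_onI)
      fix z z' assume zz: "z \<in> {z\<in>I i. t z = u}" "z' \<in> {z\<in>I i. t z = u}" "snd z = snd z'"
      obtain A B A' where zA: "z = (A, B)" "z' = (A', B)" using zz(3) by (metis prod.collapse)
      then have z: "(A, B) \<in> Z" "(A', B) \<in> Z" "lab A = i" "lab A' = i"
        using zz(1,2) by (auto simp: I_def)
      \<comment> \<open>A and A' each take two of the three vertices of B, so they meet; having the
        same label, they coincide.\<close>
      have "card (A \<inter> B) + card (A' \<inter> B) > card B"
        using Zcard[OF z(1)] Zcard[OF z(2)] T_card[OF ZT(2)[OF z(1)]] by linarith
      then have "A \<inter> A' \<noteq> {}"
        using card_Un_disjoint[of "A \<inter> B" "A' \<inter> B"] finite_triple[OF ZT(2)[OF z(1)]]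
          card_mono[of B "A \<inter> B \<union> A' \<inter> B"] by force
      then have "A = A'" using lab_disjoint ZT(1) z by blast
      then show "z = z'" using zA by simp
    qed
    then have "card {z\<in>I i. t z = u} \<le> card {B\<in>T. u \<in> B}"
    proof (rule card_inj_on_le)
      show "snd ` {z\<in>I i. t z = u} \<subseteq> {B\<in>T. u \<in> B}"
        using t ZT by (fastforce simp: I_def)
    qed (simp add: finite_T)
    then have 2: "card {z\<in>I i. t z = u} \<le> k" using card_star_le[of u] by linarith
    have "N i u = {z\<in>I i. s z = u} \<union> {z\<in>I i. t z = u}" by (auto simp: N_def)
    then have "card (N i u) \<le> card {z\<in>I i. s z = u} + card {z\<in>I i. t z = u}"
      by (simp only: card_Un_le)
    then show ?thesis using 1 2 by linarith
  qed
  show ?thesis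
  proof (rule linear_wLDC_2_of_edges[where I = I and s = s and t = t and V = "{..<n}"
        and F = "\<lambda>v b. f v (restrict_msg k L b)" and D = "2 * (real d + real k)"])
    show "additive_functional k (\<lambda>b. f v (restrict_msg k L b))" if "v \<in> {..<n}" for v
      using that f_additive by (intro additive_functional_restrict) auto
    show "finite (I i)" for i by (rule finI)
    show "s a \<in> {..<n} \<and> t a \<in> {..<n} \<and> s a \<noteq> t a" if aI: "a \<in> I i" for a i
    proof -
      obtain A B where a: "a = (A, B)" "(A, B) \<in> Z" using aI by (cases a) (auto simp: I_def)
      then show ?thesis using s[OF a(2)] t[OF a(2)] T_sub ZT(1,2)[OF a(2)] by blast
    qed
    show "f (s a) (restrict_msg k L b) + f (t a) (restrict_msg k L b) = b $ i"
      if aI: "i < k" "a \<in> I i" for i a b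
    proof -
      obtain A B where a: "a = (A, B)" and z: "(A, B) \<in> Z" and i: "lab A = i" "i \<in> L" "lab B \<notin> L"
        using aI by (cases a) (auto simp: I_def)
      define x where "x = restrict_msg k L b"
      note fin = finite_triple[OF ZT(1)[OF z]] finite_triple[OF ZT(2)[OF z]]
      have "(\<Sum>v\<in>A. f v x) = (\<Sum>v\<in>A \<inter> B. f v x) + f (s a) x"
        using sum.Int_Diff[OF fin(1), of "\<lambda>v. f v x" B] s[OF z] a by simp
      moreover have "(\<Sum>v\<in>B. f v x) = (\<Sum>v\<in>A \<inter> B. f v x) + f (t a) x"
        using sum.Int_Diff[OF fin(2), of "\<lambda>v. f v x" A] t[OF z] a by (simp add: Int_commute)
      moreover have "(\<Sum>v\<in>A. f v x) = b $ i" "(\<Sum>v\<in>B. f v x) = 0"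
        using f_sum ZT(1,2)[OF z] i lab_less aI(1) by (auto simp: x_def)
      ultimately have eq: "(\<Sum>v\<in>A \<inter> B. f v x) + f (s a) x = b $ i"
        "(\<Sum>v\<in>A \<inter> B. f v x) + f (t a) x = 0" by simp_all
      have "b $ i = ((\<Sum>v\<in>A \<inter> B. f v x) + f (s a) x) + ((\<Sum>v\<in>A \<inter> B. f v x) + f (t a) x)"
        unfolding eq by simp
      also have "\<dots> = ((\<Sum>v\<in>A \<inter> B. f v x) + (\<Sum>v\<in>A \<inter> B. f v x)) + (f (s a) x + f (t a) x)"
        by (simp only: ac_simps)
      finally show ?thesis by (simp add: x_def)
    qed
    show "(\<Sum>a\<in>I i. real (card {b\<in>I i. {s a, t a} \<inter> {s b, t b} \<noteq> {}}))
        \<le> 2 * (real d + real k) * real (card (I i))" for i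
    proof -
      have "card {b\<in>I i. {s a, t a} \<inter> {s b, t b} \<noteq> {}} \<le> 2 * (d + k)" for a
      proof -
        have "{b\<in>I i. {s a, t a} \<inter> {s b, t b} \<noteq> {}} \<subseteq> N i (s a) \<union> N i (t a)"
          by (auto simp: N_def)
        then have "card {b\<in>I i. {s a, t a} \<inter> {s b, t b} \<noteq> {}} \<le> card (N i (s a) \<union> N i (t a))"
          using finI by (intro card_mono) (auto simp: N_def)
        also have "\<dots> \<le> (d + k) + (d + k)"
          by (rule order.trans[OF card_Un_le add_mono[OF cardN cardN]])
        finally show ?thesis by simp
      qed
      then have "(\<Sum>a\<in>I i. real (card {b\<in>I i. {s a, t a} \<inter> {s b, t b} \<noteq> {}}))
          \<le> (\<Sum>a\<in>I i. real (2 * (d + k)))"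
        by (intro sum_mono of_nat_mono)
      then show ?thesis by (simp add: mult.commute)
    qed
    have "(\<Sum>i<k. card (I i)) = card {z\<in>Z. lab (fst z) \<in> L \<and> lab (snd z) \<notin> L}"
      unfolding I_def using Zfin ZT lab_less by (intro card_eq_sum_fibers) auto
    then have "card (\<Union>\<G>) * d \<le> 4 * (\<Sum>i<k. card (I i))" using L cardZ by simp
    then have "real (card (\<Union>\<G>) * d) \<le> real (4 * (\<Sum>i<k. card (I i)))"
      by (rule of_nat_mono)
    then show "4 * (2 * (real d + real k)) * (\<delta> * real n * real k) \<le> (\<Sum>i<k. real (card (I i)))"
      using total by (simp add: algebra_simps)
  qed (use d in auto)
qed

section \<open>Conflicts in the Kikuchi graph\<close>

text \<open>The set A is what remains of the 2n vertices when the four of a 4-query are removed. The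
  ratio (l - 2) / (2n - 4) is at most l / (2n) because l <= n.\<close>

lemma card_subsets_containing_le:
  fixes n l :: nat
  assumes A: "finite A" "card A = 2 * n - 4" and n: "3 \<le> n" and l: "2 \<le> l" "l \<le> n"
  shows "real (card {X. X \<subseteq> A \<and> card X = l - 2 \<and> y \<in> X})
    \<le> real l / (2 * real n) * real ((2 * n - 4) choose (l - 2))" (is "real ?c \<le> _ * real ?K")
proof (cases "y \<in> A")
  case True
  have pos: "real (2 * n - 4) > 0" using n by simp
  have "real (2 * n - 4) * real ?c = real (l - 2) * real ?K"
    using arg_cong[OF card_subsets_containing[OF A(1) True, of "l - 2"], of real]
    by (simp only: A(2) of_nat_mult)
  then have "real ?c = real (l - 2) / real (2 * n - 4) * real ?K"
    using pos by (simp add: field_simps)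
  also have "\<dots> \<le> real l / (2 * real n) * real ?K"
    using n l by (intro mult_right_mono) (auto simp: field_simps of_nat_diff)
  finally show ?thesis .
next
  case False
  then have "{X. X \<subseteq> A \<and> card X = l - 2 \<and> y \<in> X} = {}" by auto
  then have "?c = 0" by (simp only: card.empty)
  then show ?thesis by simp
qed

lemma card_subsets_containing_two_le:
  fixes n l :: nat
  assumes A: "finite A" "card A = 2 * n - 4" and n: "3 \<le> n" and l: "2 \<le> l" "l \<le> n"
    and xy: "x \<noteq> y"
  shows "real (card {X. X \<subseteq> A \<and> card X = l - 2 \<and> x \<in> X \<and> y \<in> X})
    \<le> (real l / (2 * real n))\<^sup>2 * real ((2 * n - 4) choose (l - 2))" (is "real ?c \<le> _ * real ?K")
proof (cases "x \<in> A \<and> y \<in> A")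
  case True
  have pos: "real (2 * n - 4) > 0" "real (2 * n - 4 - 1) > 0" using n by auto
  have "real (2 * n - 4) * real (2 * n - 4 - 1) * real ?c = real (l - 2) * real (l - 2 - 1) * real ?K"
    using arg_cong[OF card_subsets_containing_two[OF A(1) conjunct1[OF True] conjunct2[OF True] xy,
          of "l - 2"], of real]
    by (simp only: A(2) of_nat_mult)
  moreover have "c = (p / a) * (q / b) * K" if "a > 0" "b > 0" "a * b * c = p * q * K"
    for a b c p q K :: real
    using that by (simp add: field_simps)
  ultimately have "real ?c
      = (real (l - 2) / real (2 * n - 4)) * (real (l - 2 - 1) / real (2 * n - 4 - 1)) * real ?K"
    using pos by blast
  also have "\<dots> \<le> (real l / (2 * real n)) * (real l / (2 * real n)) * real ?K"
  proof (intro mult_right_mono mult_mono)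
    show "real (l - 2) / real (2 * n - 4) \<le> real l / (2 * real n)"
      using n l by (auto simp: field_simps of_nat_diff)
    show "real (l - 2 - 1) / real (2 * n - 4 - 1) \<le> real l / (2 * real n)"
    \<comment> \<open>At l = 2 the truncated \<open>l - 2 - 1\<close> is 0 and differs from the real
      number l - 3.\<close>
    proof (cases "l = 2")
      case False
      then have "real (l - 2 - 1) = real l - 3" "real (2 * n - 4 - 1) = 2 * real n - 5"
        using n l by (auto simp: of_nat_diff)
      then show ?thesis using n l by (auto simp: field_simps)
    qed simp
  qed auto
  finally show ?thesis by (simp add: power2_eq_square)
next
  case False
  then have "{X. X \<subseteq> A \<and> card X = l - 2 \<and> x \<in> X \<and> y \<in> X} = {}" by auto
  then have "?c = 0" by (simp only: card.empty)
  then show ?thesis by simp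
qed

text \<open>A random \<open>(l-2)\<close>-set \<open>X\<close> contains a given vertex with probability at most \<open>l / 2n\<close>.
  Edges meeting a given edge are therefore counted by how many of their two distinguished
  vertices lie in \<open>X\<close>: none, one or two contribute on average at most \<open>2d\<close>,
  \<open>O(kl/n)\<close> and \<open>O(kl\<^sup>2/n)\<close>.\<close>

lemma kikuchi_conflicts:
  fixes Q :: "'q set" and P R :: "'q \<Rightarrow> nat set" and n l k d :: nat
  defines "Xs \<equiv> \<lambda>z. {X. X \<subseteq> {..<2*n} - (P z \<union> R z) \<and> card X = l - 2}"
    and "s \<equiv> \<lambda>(z, X). X \<union> {Min (P z), Min (R z)}"
    and "t \<equiv> \<lambda>(z, X). X \<union> {Max (P z), Max (R z)}"
  assumes Q: "finite Q"
    and P: "\<And>z. z \<in> Q \<Longrightarrow> P z \<subseteq> {..<n} \<and> card (P z) = 2"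
    and R: "\<And>z. z \<in> Q \<Longrightarrow> R z \<subseteq> {n..<2*n} \<and> card (R z) = 2"
    and n: "3 \<le> n" and l: "2 \<le> l" "l \<le> n" "k * l\<^sup>2 \<le> n" and d: "1 \<le> d"
    and both: "\<And>x y. card {z\<in>Q. x \<in> P z \<and> y \<in> R z} \<le> 2 * d"
    and left: "\<And>x. card {z\<in>Q. x \<in> P z} \<le> 2 * k"
    and right: "\<And>y. card {z\<in>Q. y \<in> R z} \<le> 2 * k"
    and all: "card Q \<le> n * k"
  shows "(\<Sum>a\<in>Sigma Q Xs. real (card {b \<in> Sigma Q Xs. {s a, t a} \<inter> {s b, t b} \<noteq> {}}))
    \<le> 28 * real d * real (card (Sigma Q Xs))"
    and "card (Sigma Q Xs) = card Q * ((2 * n - 4) choose (l - 2))"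
proof -
  define K where "K = (2 * n - 4) choose (l - 2)"
  define \<rho> where "\<rho> = real l / (2 * real n)"
  \<comment> \<open>Bounds the number of edges whose \<open>s\<close> end is U, and likewise for
    \<open>t\<close>: given the 4-query z, the set X is U without the two distinguished vertices of
    z.\<close>
  define h where "h = (\<lambda>U. card {z\<in>Q. P z \<inter> U \<noteq> {} \<and> R z \<inter> U \<noteq> {}})"
  have \<rho>0: "\<rho> \<ge> 0" by (simp add: \<rho>_def)
  have base: "finite ({..<2*n} - (P z \<union> R z))" "card ({..<2*n} - (P z \<union> R z)) = 2 * n - 4"
    if "z \<in> Q" for z
  proof -
    have "P z \<inter> R z = {}" using P[OF that] R[OF that] by fastforce
    moreover have "finite (P z)" "finite (R z)"
      using P[OF that] R[OF that] finite_subset by blast+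
    ultimately have "card (P z \<union> R z) = 4" using P[OF that] R[OF that] by (simp add: card_Un_disjoint)
    moreover have "P z \<union> R z \<subseteq> {..<2*n}" using P[OF that] R[OF that] by fastforce
    ultimately show "card ({..<2*n} - (P z \<union> R z)) = 2 * n - 4"
      by (simp add: card_Diff_subset finite_subset[of _ "{..<2*n}"])
  qed simp
  have finXs: "finite (Xs z)" and cardXs: "card (Xs z) = K" if "z \<in> Q" for z
    using base[OF that] n_subsets[of "{..<2*n} - (P z \<union> R z)" "l - 2"]
    by (auto simp: Xs_def K_def)
  let ?I = "Sigma Q Xs"
  have finI: "finite ?I" using Q finXs by auto
  have cardI: "card ?I = card Q * K"
    using Q finXs cardXs by (simp add: card_SigmaI)
  then show "card ?I = card Q * ((2 * n - 4) choose (l - 2))" by (simp add: K_def)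
  have one: "real (card {X\<in>Xs z. y \<in> X}) \<le> \<rho> * K" if "z \<in> Q" for z y
    using card_subsets_containing_le[OF base[OF that] n l(1,2), of y]
    by (simp add: Xs_def \<rho>_def K_def conj_assoc)
  have two: "real (card {X\<in>Xs z. x \<in> X \<and> y \<in> X}) \<le> \<rho>\<^sup>2 * K" if "z \<in> Q" "x \<noteq> y" for z x y
    using card_subsets_containing_two_le[OF base[OF that(1)] n l(1,2) that(2)]
    by (simp add: Xs_def \<rho>_def K_def conj_assoc)
  have meet1: "real (card {X\<in>Xs z. S \<inter> X \<noteq> {}}) \<le> 2 * \<rho> * K" if z: "z \<in> Q" and S: "card S = 2" for z S
  proof -
    obtain x y where xy: "S = {x, y}" using S by (metis card_2_iff)
    have un: "{X\<in>Xs z. S \<inter> X \<noteq> {}} = {X\<in>Xs z. x \<in> X} \<union> {X\<in>Xs z. y \<in> X}" using xy by auto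
    have "real (card {X\<in>Xs z. S \<inter> X \<noteq> {}}) \<le> real (card {X\<in>Xs z. x \<in> X} + card {X\<in>Xs z. y \<in> X})"
      unfolding un by (rule of_nat_mono[OF card_Un_le])
    then show ?thesis using one[OF z, of x] one[OF z, of y] by simp
  qed
  have meet2: "real (card {X\<in>Xs z. S \<inter> X \<noteq> {} \<and> S' \<inter> X \<noteq> {}}) \<le> 4 * \<rho>\<^sup>2 * K"
    if z: "z \<in> Q" and S: "card S = 2" "card S' = 2" "S \<inter> S' = {}" for z S S'
  proof -
    have fin: "finite (S \<times> S')" using S by (metis card.infinite finite_cartesian_product zero_neq_numeral)
    have "{X\<in>Xs z. S \<inter> X \<noteq> {} \<and> S' \<inter> X \<noteq> {}} \<subseteq> (\<Union>p\<in>S \<times> S'. {X\<in>Xs z. fst p \<in> X \<and> snd p \<in> X})"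
      by fastforce
    then have "card {X\<in>Xs z. S \<inter> X \<noteq> {} \<and> S' \<inter> X \<noteq> {}}
        \<le> card (\<Union>p\<in>S \<times> S'. {X\<in>Xs z. fst p \<in> X \<and> snd p \<in> X})"
      using finXs[OF z] fin by (intro card_mono) auto
    also have "\<dots> \<le> (\<Sum>p\<in>S \<times> S'. card {X\<in>Xs z. fst p \<in> X \<and> snd p \<in> X})"
      by (rule card_UN_le[OF fin])
    finally have "real (card {X\<in>Xs z. S \<inter> X \<noteq> {} \<and> S' \<inter> X \<noteq> {}})
        \<le> (\<Sum>p\<in>S \<times> S'. real (card {X\<in>Xs z. fst p \<in> X \<and> snd p \<in> X}))"
      unfolding of_nat_sum[symmetric] by (rule of_nat_mono)
    also have "\<dots> \<le> (\<Sum>p\<in>S \<times> S'. \<rho>\<^sup>2 * K)"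
      using S(3) by (intro sum_mono two[OF z]) auto
    also have "\<dots> = 4 * \<rho>\<^sup>2 * K" using S by (simp add: card_cartesian_product)
    finally show ?thesis .
  qed
  have moment: "(\<Sum>X\<in>Xs z. real (h (X \<union> {x, y}))) \<le> 7 * real d * real K"
    if z: "z \<in> Q" and x: "x \<in> P z" and y: "y \<in> R z" for z x y
  proof -
    have xn: "x < n" "n \<le> y" using P[OF z] R[OF z] x y by auto
    define A1 where "A1 = {z\<in>Q. x \<in> P z \<and> y \<in> R z}"
    define A2 where "A2 = {z\<in>Q. x \<in> P z}"
    define A3 where "A3 = {z\<in>Q. y \<in> R z}"
    have finA: "finite A1" "finite A2" "finite A3" using Q by (auto simp: A1_def A2_def A3_def)
    have "h (X \<union> {x, y}) \<le> card A1 + card {z\<in>A2. R z \<inter> X \<noteq> {}} + card {z\<in>A3. P z \<inter> X \<noteq> {}}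
        + card {z\<in>Q. P z \<inter> X \<noteq> {} \<and> R z \<inter> X \<noteq> {}}" for X
    proof -
      \<comment> \<open>As x and y come from different copies, x can only account for meeting
        \<open>P\<close> and y only for meeting \<open>R\<close>. This leaves four cases, according
        to whether each side is met in its distinguished vertex or in X.\<close>
      have "x \<notin> R z'" "y \<notin> P z'" if "z' \<in> Q" for z' using P[OF that] R[OF that] xn by auto
      then have "{z\<in>Q. P z \<inter> (X \<union> {x, y}) \<noteq> {} \<and> R z \<inter> (X \<union> {x, y}) \<noteq> {}}
        \<subseteq> A1 \<union> {z\<in>A2. R z \<inter> X \<noteq> {}} \<union> {z\<in>A3. P z \<inter> X \<noteq> {}}
            \<union> {z\<in>Q. P z \<inter> X \<noteq> {} \<and> R z \<inter> X \<noteq> {}}"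
        unfolding A1_def A2_def A3_def by blast
      then have "h (X \<union> {x, y}) \<le> card (A1 \<union> {z\<in>A2. R z \<inter> X \<noteq> {}} \<union> {z\<in>A3. P z \<inter> X \<noteq> {}}
            \<union> {z\<in>Q. P z \<inter> X \<noteq> {} \<and> R z \<inter> X \<noteq> {}})"
        unfolding h_def using finA Q by (intro card_mono) auto
      also have "\<dots> \<le> card A1 + card {z\<in>A2. R z \<inter> X \<noteq> {}} + card {z\<in>A3. P z \<inter> X \<noteq> {}}
        + card {z\<in>Q. P z \<inter> X \<noteq> {} \<and> R z \<inter> X \<noteq> {}}"
        by (intro order.trans[OF card_Un_le] add_right_mono order.refl card_Un_le)
      finally show ?thesis .
    qed
    then have "(\<Sum>X\<in>Xs z. h (X \<union> {x, y})) \<le> (\<Sum>X\<in>Xs z. card A1 + card {z\<in>A2. R z \<inter> X \<noteq> {}}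
        + card {z\<in>A3. P z \<inter> X \<noteq> {}} + card {z\<in>Q. P z \<inter> X \<noteq> {} \<and> R z \<inter> X \<noteq> {}})"
      by (rule sum_mono)
    also have "\<dots> = K * card A1 + (\<Sum>z'\<in>A2. card {X\<in>Xs z. R z' \<inter> X \<noteq> {}})
        + (\<Sum>z'\<in>A3. card {X\<in>Xs z. P z' \<inter> X \<noteq> {}})
        + (\<Sum>z'\<in>Q. card {X\<in>Xs z. P z' \<inter> X \<noteq> {} \<and> R z' \<inter> X \<noteq> {}})"
      unfolding sum.distrib sum_card_swap[OF finXs[OF z] finA(2)] sum_card_swap[OF finXs[OF z] finA(3)]
        sum_card_swap[OF finXs[OF z] Q] using cardXs[OF z] by simp
    finally have "real (\<Sum>X\<in>Xs z. h (X \<union> {x, y})) \<le> real (K * card A1 + (\<Sum>z'\<in>A2. card {X\<in>Xs z. R z' \<inter> X \<noteq> {}})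
        + (\<Sum>z'\<in>A3. card {X\<in>Xs z. P z' \<inter> X \<noteq> {}})
        + (\<Sum>z'\<in>Q. card {X\<in>Xs z. P z' \<inter> X \<noteq> {} \<and> R z' \<inter> X \<noteq> {}}))"
      by (rule of_nat_mono)
    then have "(\<Sum>X\<in>Xs z. real (h (X \<union> {x, y}))) \<le> real K * real (card A1)
        + (\<Sum>z'\<in>A2. real (card {X\<in>Xs z. R z' \<inter> X \<noteq> {}}))
        + (\<Sum>z'\<in>A3. real (card {X\<in>Xs z. P z' \<inter> X \<noteq> {}}))
        + (\<Sum>z'\<in>Q. real (card {X\<in>Xs z. P z' \<inter> X \<noteq> {} \<and> R z' \<inter> X \<noteq> {}}))"
      by simp
    \<comment> \<open>With \<rho> = l / (2n) the two mixed terms add up to 4kl/n and the last one is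
      kl^2/n, both per unit of K. As kl <= kl^2 <= n, the sum is at most 2d + 5, hence at most
      7d.\<close>
    also have "\<dots> \<le> real K * (2 * real d) + real (2 * k) * (2 * \<rho> * K) + real (2 * k) * (2 * \<rho> * K)
        + real (n * k) * (4 * \<rho>\<^sup>2 * K)"
    proof (intro add_mono)
      have "real (card A1) \<le> real (2 * d)" unfolding A1_def by (rule of_nat_mono[OF both])
      then show "real K * real (card A1) \<le> real K * (2 * real d)" by (intro mult_left_mono) auto
      have "(\<Sum>z'\<in>A2. real (card {X\<in>Xs z. R z' \<inter> X \<noteq> {}})) \<le> (\<Sum>z'\<in>A2. 2 * \<rho> * K)"
        using R by (intro sum_mono meet1 z) (auto simp: A2_def)
      also have "\<dots> = real (card A2) * (2 * \<rho> * K)" by simp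
      also have "\<dots> \<le> real (2 * k) * (2 * \<rho> * K)"
        using left[of x] \<rho>0 unfolding A2_def by (intro mult_right_mono of_nat_mono) auto
      finally show "(\<Sum>z'\<in>A2. real (card {X\<in>Xs z. R z' \<inter> X \<noteq> {}})) \<le> real (2 * k) * (2 * \<rho> * K)" .
      have "(\<Sum>z'\<in>A3. real (card {X\<in>Xs z. P z' \<inter> X \<noteq> {}})) \<le> (\<Sum>z'\<in>A3. 2 * \<rho> * K)"
        using P by (intro sum_mono meet1 z) (auto simp: A3_def)
      also have "\<dots> = real (card A3) * (2 * \<rho> * K)" by simp
      also have "\<dots> \<le> real (2 * k) * (2 * \<rho> * K)"
        using right[of y] \<rho>0 unfolding A3_def by (intro mult_right_mono of_nat_mono) auto
      finally show "(\<Sum>z'\<in>A3. real (card {X\<in>Xs z. P z' \<inter> X \<noteq> {}})) \<le> real (2 * k) * (2 * \<rho> * K)" .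
      have "(\<Sum>z'\<in>Q. real (card {X\<in>Xs z. P z' \<inter> X \<noteq> {} \<and> R z' \<inter> X \<noteq> {}})) \<le> (\<Sum>z'\<in>Q. 4 * \<rho>\<^sup>2 * K)"
        using P R by (intro sum_mono meet2 z) fastforce+
      also have "\<dots> = real (card Q) * (4 * \<rho>\<^sup>2 * K)" by simp
      also have "\<dots> \<le> real (n * k) * (4 * \<rho>\<^sup>2 * K)"
        using all by (intro mult_right_mono of_nat_mono) auto
      finally show "(\<Sum>z'\<in>Q. real (card {X\<in>Xs z. P z' \<inter> X \<noteq> {} \<and> R z' \<inter> X \<noteq> {}}))
          \<le> real (n * k) * (4 * \<rho>\<^sup>2 * K)" .
    qed
    also have "\<dots> = real K * (2 * real d + 4 * (real k * real l / real n) + real k * (real l)\<^sup>2 / real n)"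
      using n by (simp add: \<rho>_def field_simps power2_eq_square)
    also have "\<dots> \<le> real K * (2 * real d + 4 * 1 + 1)"
    proof (intro mult_left_mono add_mono order.refl)
      have "real (k * l\<^sup>2) \<le> real n" using l(3) by (rule of_nat_mono)
      then show *: "real k * (real l)\<^sup>2 / real n \<le> 1" using n by (simp add: field_simps)
      have "real k * real l \<le> real k * (real l)\<^sup>2"
        using l(1) by (intro mult_left_mono) (auto simp: power2_eq_square)
      then have "real k * real l / real n \<le> real k * (real l)\<^sup>2 / real n"
        by (rule divide_right_mono) simp
      then show "real k * real l / real n \<le> 1" using * by linarith
    qed auto
    also have "\<dots> \<le> real K * (7 * real d)" using d by (intro mult_left_mono) auto
    finally show ?thesis by (simp add: mult_ac)
  qed
  have count: "card {b\<in>?I. snd b \<union> {p (fst b), r (fst b)} = U} \<le> h U"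
    if p: "\<And>z. z \<in> Q \<Longrightarrow> p z \<in> P z" and r: "\<And>z. z \<in> Q \<Longrightarrow> r z \<in> R z" for p r U
    unfolding h_def
  proof (rule card_inj_on_le)
    show "inj_on fst {b\<in>?I. snd b \<union> {p (fst b), r (fst b)} = U}"
    proof (rule inj_onI)
      fix a b assume ab: "a \<in> {b\<in>?I. snd b \<union> {p (fst b), r (fst b)} = U}"
        "b \<in> {b\<in>?I. snd b \<union> {p (fst b), r (fst b)} = U}" "fst a = fst b"
      have "snd c = U - {p (fst c), r (fst c)}"
        if "c \<in> {b\<in>?I. snd b \<union> {p (fst b), r (fst b)} = U}" for c
      proof -
        have c: "fst c \<in> Q" "snd c \<in> Xs (fst c)" "snd c \<union> {p (fst c), r (fst c)} = U"
          using that by auto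
        have "p (fst c) \<notin> snd c" "r (fst c) \<notin> snd c"
          using c(2) p[OF c(1)] r[OF c(1)] by (auto simp: Xs_def)
        then show ?thesis using c(3) by blast
      qed
      from this[OF ab(1)] this[OF ab(2)] show "a = b" using ab(3) by (simp add: prod_eq_iff)
    qed
    show "fst ` {b\<in>?I. snd b \<union> {p (fst b), r (fst b)} = U} \<subseteq> {z\<in>Q. P z \<inter> U \<noteq> {} \<and> R z \<inter> U \<noteq> {}}"
      using p r by fastforce
  qed (use Q in simp)
  have mP: "Min (P z) \<in> P z" "Max (P z) \<in> P z" and mR: "Min (R z) \<in> R z" "Max (R z) \<in> R z"
    if "z \<in> Q" for z
    using card_2_Min_Max P[OF that] R[OF that] by auto
  have sc: "card {b\<in>?I. s b = U} \<le> h U" for U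
    using count[of "\<lambda>z. Min (P z)" "\<lambda>z. Min (R z)" U] mP mR by (simp add: s_def case_prod_beta)
  have tc: "card {b\<in>?I. t b = U} \<le> h U" for U
    using count[of "\<lambda>z. Max (P z)" "\<lambda>z. Max (R z)" U] mP mR by (simp add: t_def case_prod_beta)
  \<comment> \<open>Either end of a may be either end of b. These four coincidences, each costing 7d
    on average, give the constant 28.\<close>
  have conf: "real (card {b\<in>?I. {s a, t a} \<inter> {s b, t b} \<noteq> {}}) \<le> 2 * real (h (s a)) + 2 * real (h (t a))" for a
  proof -
    have "card {b\<in>?I. {s a, t a} \<inter> {s b, t b} \<noteq> {}}
      \<le> card (({b\<in>?I. s b = s a} \<union> {b\<in>?I. t b = s a}) \<union> ({b\<in>?I. s b = t a} \<union> {b\<in>?I. t b = t a}))"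
      using finI by (intro card_mono) auto
    also have "\<dots> \<le> (h (s a) + h (s a)) + (h (t a) + h (t a))"
      by (intro order.trans[OF card_Un_le] add_mono sc tc)
    finally show ?thesis by linarith
  qed
  have "(\<Sum>a\<in>?I. real (card {b\<in>?I. {s a, t a} \<inter> {s b, t b} \<noteq> {}}))
      \<le> (\<Sum>a\<in>?I. 2 * real (h (s a)) + 2 * real (h (t a)))"
    by (rule sum_mono[OF conf])
  also have "\<dots> = (\<Sum>z\<in>Q. \<Sum>X\<in>Xs z. 2 * real (h (s (z, X))) + 2 * real (h (t (z, X))))"
    using Q finXs by (subst sum.Sigma) auto
  also have "\<dots> = (\<Sum>z\<in>Q. 2 * (\<Sum>X\<in>Xs z. real (h (X \<union> {Min (P z), Min (R z)})))
      + 2 * (\<Sum>X\<in>Xs z. real (h (X \<union> {Max (P z), Max (R z)}))))"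
    unfolding s_def t_def by (simp only: prod.case sum.distrib sum_distrib_left)
  also have "\<dots> \<le> (\<Sum>z\<in>Q. 2 * (7 * real d * real K) + 2 * (7 * real d * real K))"
    using mP mR by (intro sum_mono add_mono mult_left_mono moment) auto
  also have "\<dots> = 28 * real d * real (card ?I)" by (simp add: cardI)
  finally show "(\<Sum>a\<in>?I. real (card {b\<in>?I. {s a, t a} \<inter> {s b, t b} \<noteq> {}}))
    \<le> 28 * real d * real (card ?I)" .
qed

section \<open>The Kikuchi code\<close>

text \<open>A 4-query yields one edge per (l - 2)-subset of the other 2n - 4 vertices, so its edges
  number at least a fraction of order (l / n)^2 of all l-subsets. The exact ratio is
  2n(2n-1)(2n-2)(2n-3) over l(l-1)(2n-l)(2n-l-1); the numerator is at most 16 n^4 and, as 2 <= l <=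
  n, the denominator is at least l^2 n^2 / 4.\<close>

lemma binomial_descend_four:
  fixes n l :: nat
  assumes n: "2 \<le> n" and l: "2 \<le> l" "l \<le> n"
  shows "real (2 * n choose l) * (real l)\<^sup>2 \<le> 64 * (real n)\<^sup>2 * real ((2 * n - 4) choose (l - 2))"
proof -
  obtain m j where m: "2 * n = m + 4" and j: "l = j + 2"
    using n l by (metis add.commute le_Suc_ex mult_2 nat_mult_le_cancel_disj numeral_Bit0)
  have jm: "j \<le> m" using l m j by linarith
  define c0 c1 c2 c3 c4 where c: "c0 = real (m + 4 choose (j + 2))" "c1 = real (m + 3 choose (j + 1))"
    "c2 = real (m + 2 choose j)" "c3 = real (m + 1 choose j)" "c4 = real (m choose j)"
  have 1: "(j + 2) * (m + 4 choose (j + 2)) = (m + 4) * (m + 3 choose (j + 1))"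
    using Suc_times_binomial[of "j + 1" "m + 3"] by (simp add: numeral_eq_Suc)
  have 2: "(j + 1) * (m + 3 choose (j + 1)) = (m + 3) * (m + 2 choose j)"
    using Suc_times_binomial[of j "m + 2"] by (simp add: numeral_eq_Suc)
  have 3: "(m + 2 - j) * (m + 2 choose j) = (m + 2) * (m + 1 choose j)"
    using binomial_absorb_comp[of "m + 2" j] by simp
  have 4: "(m + 1 - j) * (m + 1 choose j) = (m + 1) * (m choose j)"
    using binomial_absorb_comp[of "m + 1" j] by simp
  have r1: "(real j + 2) * c0 = (real m + 4) * c1"
    using arg_cong[OF 1, of real] unfolding c by (simp only: of_nat_mult of_nat_add of_nat_numeral)
  have r2: "(real j + 1) * c1 = (real m + 3) * c2"
    using arg_cong[OF 2, of real] unfolding c by (simp only: of_nat_mult of_nat_add of_nat_numeral of_nat_1)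
  have r3: "(real m + 2 - real j) * c2 = (real m + 2) * c3"
    using arg_cong[OF 3, of real] jm unfolding c by (simp only: of_nat_mult of_nat_add of_nat_numeral of_nat_diff trans_le_add1)
  have r4: "(real m + 1 - real j) * c3 = (real m + 1) * c4"
    using arg_cong[OF 4, of real] jm unfolding c by (simp only: of_nat_mult of_nat_add of_nat_numeral of_nat_diff trans_le_add1 of_nat_1)
  have chain: "a * b * c * e * x0 = p * q * r * u * x4"
    if "a * x0 = p * x1" "b * x1 = q * x2" "c * x2 = r * x3" "e * x3 = u * x4"
    for a b c e p q r u x0 x1 x2 x3 x4 :: real
  proof -
    have "a * b * c * e * x0 = b * c * e * (a * x0)" by (simp only: mult_ac)
    also have "\<dots> = p * c * e * (b * x1)" unfolding that(1) by (simp only: mult_ac)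
    also have "\<dots> = p * q * e * (c * x2)" unfolding that(2) by (simp only: mult_ac)
    also have "\<dots> = p * q * r * (e * x3)" unfolding that(3) by (simp only: mult_ac)
    finally show ?thesis unfolding that(4) by (simp only: mult_ac)
  qed
  have "(real j + 2) * (real j + 1) * (real m + 2 - real j) * (real m + 1 - real j) * c0
      = (real m + 4) * (real m + 3) * (real m + 2) * (real m + 1) * c4"
    by (rule chain[OF r1 r2 r3 r4])
  moreover have "(real m + 4) * (real m + 3) * (real m + 2) * (real m + 1) * c4
      \<le> (2 * real n) * (2 * real n) * (2 * real n) * (2 * real n) * c4"
  proof -
    have "real m + 4 = 2 * real n" using arg_cong[OF m, of real] by simp
    then show ?thesis by (intro mult_right_mono mult_mono) (auto simp: c)
  qed
  moreover have "(real l)\<^sup>2 * (real n)\<^sup>2 / 4 * c0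
      \<le> (real j + 2) * (real j + 1) * (real m + 2 - real j) * (real m + 1 - real j) * c0"
  proof (rule mult_right_mono)
    have mn: "real m + 4 = 2 * real n" using arg_cong[OF m, of real] by simp
    have jl: "real j + 2 = real l" using j by simp
    have "(real l)\<^sup>2 * (real n)\<^sup>2 / 4 = real l * (real l / 2) * real n * (real n / 2)"
      by (simp add: power2_eq_square)
    also have "\<dots> \<le> (real j + 2) * (real j + 1) * (real m + 2 - real j) * (real m + 1 - real j)"
      using mn jl n l jm by (intro mult_mono) auto
    finally show "(real l)\<^sup>2 * (real n)\<^sup>2 / 4
      \<le> (real j + 2) * (real j + 1) * (real m + 2 - real j) * (real m + 1 - real j)" .
  qed (simp add: c)
  ultimately have "(real l)\<^sup>2 * (real n)\<^sup>2 / 4 * c0 \<le> 16 * (real n)\<^sup>2 * (real n)\<^sup>2 * c4"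
    by (simp add: power2_eq_square mult_ac)
  then have "(real n)\<^sup>2 * (c0 * (real l)\<^sup>2) \<le> (real n)\<^sup>2 * (64 * (real n)\<^sup>2 * c4)"
    by (simp add: field_simps)
  then have "c0 * (real l)\<^sup>2 \<le> 64 * (real n)\<^sup>2 * c4"
    by (rule mult_left_le_imp_le) (use n in simp)
  moreover have "c0 = real (2 * n choose l)" "c4 = real ((2 * n - 4) choose (l - 2))"
    using m j by (simp_all add: c)
  ultimately show ?thesis by simp
qed

text \<open>Here \<open>e\<close> stands for the common contribution of X and \<open>w\<close> for
  the vertex shared by the two triples; each occurs twice and vanishes.\<close>

lemma bit_sum_cancel:
  fixes a a' c c' e w r :: bit
  assumes "w + (a + a') = r" "w + (c + c') = 0"
  shows "(a + (c + e)) + (a' + (c' + e)) = r"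
proof -
  have "(a + (c + e)) + (a' + (c' + e)) = (e + e) + ((a + a') + (c + c'))" by (simp only: ac_simps)
  also have "\<dots> = (w + w) + ((a + a') + (c + c'))" by (simp only: bit_add_self)
  also have "\<dots> = (w + (a + a')) + (w + (c + c'))" by (simp only: ac_simps)
  finally show ?thesis using assms by simp
qed

context labelled_triples
begin

text \<open>Pairs are ordered because the first triple supplies the bit to be decoded. The common
  vertex is recorded, since triples sharing two vertices give two 4-queries.\<close>

definition intersecting :: "nat set set \<Rightarrow> (nat set \<times> nat \<times> nat set) set" where
  "intersecting W = {(A, w, B). A \<in> W \<and> B \<in> W \<and> w \<in> A \<and> w \<in> B \<and> A \<noteq> B}"

lemma finite_intersecting:
  assumes "W \<subseteq> T"
  shows "finite (intersecting W)"
proof (rule finite_subset)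
  show "intersecting W \<subseteq> T \<times> {..<n} \<times> T"
    using assms T_sub by (auto simp: intersecting_def)
qed (simp add: finite_T)

text \<open>Cauchy-Schwarz for the vertex degrees in W, in the form that their variance is
  nonnegative. The degrees sum to \<open>3 * card W\<close>; their squares count ordered pairs with
  a marked common vertex, of which at most \<open>3 * card W\<close> are diagonal.\<close>

lemma card_intersecting_ge:
  assumes W: "W \<subseteq> T"
  shows "9 * (real (card W))\<^sup>2 \<le> real n * (real (card (intersecting W)) + 3 * real (card W))"
proof -
  have finW: "finite W" using W finite_T finite_subset by blast
  define t where "t = (\<lambda>w. card {A\<in>W. w \<in> A})"
  have "(\<Sum>w<n. t w) = (\<Sum>A\<in>W. card {w\<in>{..<n}. w \<in> A})"
    unfolding t_def by (rule sum_card_swap) (auto simp: finW)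
  also have "\<dots> = (\<Sum>A\<in>W. 3)"
  proof (rule sum.cong[OF refl])
    fix A assume "A \<in> W"
    then have "A \<in> T" using W by blast
    moreover have "{w\<in>{..<n}. w \<in> A} = A" using T_sub[OF \<open>A \<in> T\<close>] by blast
    ultimately show "card {w\<in>{..<n}. w \<in> A} = 3" using T_card by simp
  qed
  finally have tsum: "(\<Sum>w<n. t w) = 3 * card W" by simp
  have diag: "card ((\<lambda>(A, w). (A, w, A)) ` (SIGMA A:W. A)) \<le> 3 * card W"
  proof -
    have "card ((\<lambda>(A, w). (A, w, A)) ` (SIGMA A:W. A)) \<le> card (SIGMA A:W. A)"
      using finW W finite_triple by (intro card_image_le) auto
    also have "\<dots> = (\<Sum>A\<in>W. card A)"
      using finW W finite_triple by (intro card_SigmaI) auto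
    also have "\<dots> = (\<Sum>A\<in>W. 3)" using W T_card by (intro sum.cong) auto
    finally show ?thesis by simp
  qed
  have "(\<Sum>w<n. (t w)\<^sup>2) = card (SIGMA w:{..<n}. {A\<in>W. w \<in> A} \<times> {A\<in>W. w \<in> A})"
    using finW by (simp add: t_def power2_eq_square card_cartesian_product)
  also have "\<dots> = card ((\<lambda>(w, A, B). (A, w, B)) ` (SIGMA w:{..<n}. {A\<in>W. w \<in> A} \<times> {A\<in>W. w \<in> A}))"
    by (intro card_image[symmetric] inj_onI) auto
  also have "\<dots> \<le> card (intersecting W \<union> (\<lambda>(A, w). (A, w, A)) ` (SIGMA A:W. A))"
    using finW W finite_triple finite_intersecting
    by (intro card_mono) (auto simp: intersecting_def image_iff)
  also have "\<dots> \<le> card (intersecting W) + 3 * card W"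
    by (intro order.trans[OF card_Un_le] add_left_mono diag)
  finally have "real (\<Sum>w<n. (t w)\<^sup>2) \<le> real (card (intersecting W) + 3 * card W)"
    by (rule of_nat_mono)
  then have sq: "(\<Sum>w<n. (real (t w))\<^sup>2) \<le> real (card (intersecting W)) + 3 * real (card W)"
    by simp
  have tsum': "(\<Sum>w<n. real (t w)) = 3 * real (card W)"
    using arg_cong[OF tsum, of real] by simp
  show ?thesis
  proof (cases "n = 0")
    case True
    then have "card W = 0" using tsum by simp
    then show ?thesis by simp
  next
    case False
    define a where "a = 3 * real (card W) / real n"
    have "0 \<le> (\<Sum>w<n. (real (t w) - a)\<^sup>2)" by (simp add: sum_nonneg)
    also have "\<dots> = (\<Sum>w<n. (real (t w))\<^sup>2) - 2 * a * (\<Sum>w<n. real (t w)) + real n * a\<^sup>2"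
      by (simp add: power2_diff sum.distrib sum_subtractf sum_distrib_left mult_ac)
    also have "\<dots> = (\<Sum>w<n. (real (t w))\<^sup>2) - 9 * (real (card W))\<^sup>2 / real n"
      unfolding tsum' a_def using False by (simp add: field_simps power2_eq_square)
    finally have "9 * (real (card W))\<^sup>2 / real n \<le> real (card (intersecting W)) + 3 * real (card W)"
      using sq by linarith
    then show ?thesis using False by (simp add: field_simps)
  qed
qed

text \<open>The coordinate at an l-subset is the sum of the codeword over it, vertex v of the
  doubled set being read as \<open>v mod n\<close>; X then cancels between the two ends of an edge.
  The constant 448 is 4 for the cut times 4 * 28 for the extraction.\<close>

lemma wLDC_2_kikuchi:
  assumes W: "W \<subseteq> T" and d: "1 \<le> d"
    and light: "\<And>p. card p = 2 \<Longrightarrow> card {A\<in>W. p \<subseteq> A} \<le> d"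
    and n: "3 \<le> n" and l: "2 \<le> l" "l \<le> n" "k * l\<^sup>2 \<le> n"
    and total: "448 * real d * (\<delta> * real (2 * n choose l) * real k)
      \<le> real (card (intersecting W)) * real ((2 * n - 4) choose (l - 2))"
  shows "\<exists>C. linear_wLDC 2 \<delta> k (2 * n choose l) C"
proof -
  define Z where "Z = intersecting W"
  have finZ: "finite Z" unfolding Z_def by (rule finite_intersecting[OF W])
  have ZD: "A \<in> W" "B \<in> W" "A \<in> T" "B \<in> T" "w \<in> A" "w \<in> B" "A \<noteq> B" "w < n"
    if "(A, w, B) \<in> Z" for A w B
    using that W T_sub by (auto simp: Z_def intersecting_def)
  define la where "la = (\<lambda>(A, w::nat, B::nat set). lab A)"
  define lb where "lb = (\<lambda>(A::nat set, w::nat, B). lab B)"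
  have lab_lt: "la z < k" "lb z < k" if "z \<in> Z" for z
    using that ZD(3,4)[of "fst z" "fst (snd z)" "snd (snd z)"] lab_less
    by (simp_all add: la_def lb_def case_prod_beta)
  have neq: "la z \<noteq> lb z" if "z \<in> Z" for z
    using that ZD(3-7)[of "fst z" "fst (snd z)" "snd (snd z)"]
      lab_disjoint[of "fst z" "snd (snd z)" "fst (snd z)"]
    by (auto simp: la_def lb_def case_prod_beta)
  have "\<exists>L. card Z \<le> 4 * card {z\<in>Z. la z \<in> L \<and> lb z \<notin> L}"
    by (rule exists_cut[of Z la k lb, OF finZ lab_lt neq])
  then obtain L where L: "card Z \<le> 4 * card {z\<in>Z. la z \<in> L \<and> lb z \<notin> L}" ..
  define Q where "Q = (\<lambda>i. {z \<in> {z\<in>Z. la z \<in> L \<and> lb z \<notin> L}. la z = i})"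
  define P where "P = (\<lambda>(A, w::nat, B::nat set). A - {w})"
  \<comment> \<open>The shift into the second copy keeps \<open>P z\<close> and \<open>R z\<close>
    disjoint even if the two triples share a second vertex.\<close>
  define R where "R = (\<lambda>(A::nat set, w, B). (+) n ` (B - {w}))"
  have finQ: "finite (Q i)" for i using finZ by (simp add: Q_def)
  have QD: "(A, w, B) \<in> Z" "lab A = i" "i \<in> L" "lab B \<notin> L" if "(A, w, B) \<in> Q i" for A w B i
    using that by (auto simp: Q_def la_def lb_def)
  have QP: "P z \<subseteq> {..<n} \<and> card (P z) = 2" if z: "z \<in> Q i" for z i
  proof -
    obtain A w B where zz: "z = (A, w, B)" by (cases z)
    note A = ZD(3,5)[OF QD(1)[OF z[unfolded zz]]]
    show ?thesis using zz A T_sub[OF A(1)] T_card[OF A(1)] finite_triple[OF A(1)] by (auto simp: P_def)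
  qed
  have QR: "R z \<subseteq> {n..<2*n} \<and> card (R z) = 2" if z: "z \<in> Q i" for z i
  proof -
    obtain A w B where zz: "z = (A, w, B)" by (cases z)
    note B = ZD(4,6)[OF QD(1)[OF z[unfolded zz]]]
    have "card (R z) = card (B - {w})"
      using zz by (simp add: R_def card_image)
    then show ?thesis
      using zz B T_sub[OF B(1)] T_card[OF B(1)] finite_triple[OF B(1)] by (auto simp: R_def)
  qed
  \<comment> \<open>Label i and vertex x determine A, and w is one of the two other vertices of A.
    Then B contains w and the original y' of y, a pair lying in at most d triples of W.\<close>
  have both: "card {z\<in>Q i. x \<in> P z \<and> y \<in> R z} \<le> 2 * d" for x y i
  proof (cases "{z\<in>Q i. x \<in> P z \<and> y \<in> R z} = {}")
    case True
    then show ?thesis by (metis card.empty zero_le)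
  next
    case False
    then obtain z0 where z0: "z0 \<in> Q i" "x \<in> P z0" "y \<in> R z0" by blast
    obtain A0 w0 B0 where "z0 = (A0, w0, B0)" by (cases z0)
    with z0 have A0: "(A0, w0, B0) \<in> Q i" "x \<in> P (A0, w0, B0)" "y \<in> R (A0, w0, B0)" by simp_all
    from A0(3) obtain y' where y: "y = n + y'" by (auto simp: R_def)
    have A0T: "A0 \<in> T" "lab A0 = i" "x \<in> A0"
      using ZD(3)[OF QD(1)[OF A0(1)]] QD(2)[OF A0(1)] A0(2) by (auto simp: P_def)
    let ?B = "\<lambda>w. {B\<in>W. w \<noteq> y' \<and> {y', w} \<subseteq> B}"
    have finW: "finite W" using W finite_T finite_subset by blast
    have "{z\<in>Q i. x \<in> P z \<and> y \<in> R z} \<subseteq> Pair A0 ` (SIGMA w:A0 - {x}. ?B w)"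
    proof clarify
      fix A w B assume z: "(A, w, B) \<in> Q i" "x \<in> P (A, w, B)" "y \<in> R (A, w, B)"
      have AB: "x \<in> A" "x \<noteq> w" "y' \<in> B" "y' \<noteq> w" using z(2,3) y by (auto simp: P_def R_def)
      have "A = A0"
        by (rule lab_disjoint[OF ZD(3)[OF QD(1)[OF z(1)]] A0T(1) _ AB(1) A0T(3)])
          (simp only: QD(2)[OF z(1)] A0T(2))
      then show "(A, w, B) \<in> Pair A0 ` (SIGMA w:A0 - {x}. ?B w)"
        using AB ZD[OF QD(1)[OF z(1)]] by auto
    qed
    then have "card {z\<in>Q i. x \<in> P z \<and> y \<in> R z} \<le> card (Pair A0 ` (SIGMA w:A0 - {x}. ?B w))"
      using finW finite_triple[OF A0T(1)] by (intro card_mono) auto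
    also have "\<dots> \<le> card (SIGMA w:A0 - {x}. ?B w)"
      using finW finite_triple[OF A0T(1)] by (intro card_image_le) auto
    also have "\<dots> = (\<Sum>w\<in>A0 - {x}. card (?B w))"
      using finW finite_triple[OF A0T(1)] by (intro card_SigmaI) auto
    also have "\<dots> \<le> (\<Sum>w\<in>A0 - {x}. d)"
    proof (rule sum_mono)
      fix w
      show "card (?B w) \<le> d"
      proof (cases "w = y'")
        case False
        then show ?thesis using light[of "{y', w}"] by simp
      qed simp
    qed
    also have "\<dots> = 2 * d" using T_card[OF A0T(1)] A0T(3) finite_triple[OF A0T(1)] by simp
    finally show ?thesis .
  qed
  \<comment> \<open>Again A is determined and w has two values, but B may now be any of the at most
    k triples through w.\<close>
  have left: "card {z\<in>Q i. x \<in> P z} \<le> 2 * k" for x i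
  proof (cases "{z\<in>Q i. x \<in> P z} = {}")
    case True
    then show ?thesis by (metis card.empty zero_le)
  next
    case False
    then obtain z0 where z0: "z0 \<in> Q i" "x \<in> P z0" by blast
    obtain A0 w0 B0 where "z0 = (A0, w0, B0)" by (cases z0)
    with z0 have A0: "(A0, w0, B0) \<in> Q i" "x \<in> P (A0, w0, B0)" by simp_all
    have A0T: "A0 \<in> T" "lab A0 = i" "x \<in> A0"
      using ZD(3)[OF QD(1)[OF A0(1)]] QD(2)[OF A0(1)] A0(2) by (auto simp: P_def)
    let ?B = "\<lambda>w. {B\<in>T. w \<in> B}"
    have "{z\<in>Q i. x \<in> P z} \<subseteq> Pair A0 ` (SIGMA w:A0 - {x}. ?B w)"
    proof clarify
      fix A w B assume z: "(A, w, B) \<in> Q i" "x \<in> P (A, w, B)"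
      have AB: "x \<in> A" "x \<noteq> w" using z(2) by (auto simp: P_def)
      have "A = A0"
        by (rule lab_disjoint[OF ZD(3)[OF QD(1)[OF z(1)]] A0T(1) _ AB(1) A0T(3)])
          (simp only: QD(2)[OF z(1)] A0T(2))
      then show "(A, w, B) \<in> Pair A0 ` (SIGMA w:A0 - {x}. ?B w)"
        using AB ZD[OF QD(1)[OF z(1)]] by auto
    qed
    then have "card {z\<in>Q i. x \<in> P z} \<le> card (Pair A0 ` (SIGMA w:A0 - {x}. ?B w))"
      using finite_T finite_triple[OF A0T(1)] by (intro card_mono) auto
    also have "\<dots> \<le> card (SIGMA w:A0 - {x}. ?B w)"
      using finite_T finite_triple[OF A0T(1)] by (intro card_image_le) auto
    also have "\<dots> = (\<Sum>w\<in>A0 - {x}. card (?B w))"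
      using finite_T finite_triple[OF A0T(1)] by (intro card_SigmaI) auto
    also have "\<dots> \<le> (\<Sum>w\<in>A0 - {x}. k)" by (intro sum_mono card_star_le)
    also have "\<dots> = 2 * k" using T_card[OF A0T(1)] A0T(3) finite_triple[OF A0T(1)] by simp
    finally show ?thesis .
  qed
  \<comment> \<open>Only one triple of label i passes through w, so A can be forgotten in the next
    two counts.\<close>
  have inj: "inj_on snd (Q i)" for i
  proof (rule inj_onI)
    fix z z' assume zz: "z \<in> Q i" "z' \<in> Q i" "snd z = snd z'"
    obtain A w B A' where e: "z = (A, w, B)" "z' = (A', w, B)" using zz(3) by (metis prod.collapse)
    note q = QD[OF zz(1)[unfolded e]] QD[OF zz(2)[unfolded e]]
    have "A = A'"
      by (rule lab_disjoint[OF ZD(3)[OF q(1)] ZD(3)[OF q(5)] _ ZD(5)[OF q(1)] ZD(5)[OF q(5)]])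
        (simp only: q(2,6))
    then show "z = z'" using e by simp
  qed
  have right: "card {z\<in>Q i. y \<in> R z} \<le> 2 * k" for y i
  proof -
    let ?B = "{B\<in>T. y - n \<in> B}"
    have finS: "finite (SIGMA B:?B. B - {y - n})"
      using finite_T finite_triple by (intro finite_SigmaI) auto
    have "card {z\<in>Q i. y \<in> R z} = card (snd ` {z\<in>Q i. y \<in> R z})"
      by (rule card_image[symmetric], rule inj_on_subset[OF inj[of i]]) auto
    also have "\<dots> \<le> card ((\<lambda>(B, w). (w, B)) ` (SIGMA B:?B. B - {y - n}))"
    proof (rule card_mono)
      show "snd ` {z\<in>Q i. y \<in> R z} \<subseteq> (\<lambda>(B, w). (w, B)) ` (SIGMA B:?B. B - {y - n})"
      proof (rule image_subsetI)
        fix z' assume z': "z' \<in> {z\<in>Q i. y \<in> R z}"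
        obtain A w B where e: "z' = (A, w, B)" by (cases z')
        have z: "(A, w, B) \<in> Q i" "y \<in> R (A, w, B)" using z' e by auto
        have "y - n \<in> B" "y - n \<noteq> w" using z(2) by (auto simp: R_def)
        then have "(B, w) \<in> (SIGMA B:?B. B - {y - n})" using ZD[OF QD(1)[OF z(1)]] by auto
        then show "snd z' \<in> (\<lambda>(B, w). (w, B)) ` (SIGMA B:?B. B - {y - n})"
          unfolding e snd_conv by (rule rev_image_eqI) simp
      qed
    qed (rule finite_imageI[OF finS])
    also have "\<dots> \<le> card (SIGMA B:?B. B - {y - n})"
      by (rule card_image_le[OF finS])
    also have "\<dots> = (\<Sum>B\<in>?B. card (B - {y - n}))"
      using finite_T finite_triple by (intro card_SigmaI) auto
    also have "\<dots> = (\<Sum>B\<in>?B. 2)"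
      using T_card finite_triple by (intro sum.cong) auto
    also have "\<dots> \<le> 2 * k" using card_star_le[of "y - n"] by simp
    finally show ?thesis .
  qed
  have all: "card (Q i) \<le> n * k" for i
  proof -
    have "card (Q i) = card (snd ` Q i)" by (rule card_image[symmetric, OF inj])
    also have "\<dots> \<le> card (SIGMA w:{..<n}. {B\<in>T. w \<in> B})"
    proof (rule card_mono)
      show "snd ` Q i \<subseteq> (SIGMA w:{..<n}. {B\<in>T. w \<in> B})"
      proof (rule image_subsetI)
        fix z' assume z: "z' \<in> Q i"
        obtain A w B where e: "z' = (A, w, B)" by (cases z')
        show "snd z' \<in> (SIGMA w:{..<n}. {B\<in>T. w \<in> B})"
          using ZD[OF QD(1)[OF z[unfolded e]]] e by auto
      qed
    qed (use finite_T in auto)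
    also have "\<dots> = (\<Sum>w<n. card {B\<in>T. w \<in> B})"
      using finite_T by (intro card_SigmaI) auto
    also have "\<dots> \<le> (\<Sum>w<n. k)" by (intro sum_mono card_star_le)
    finally show ?thesis by simp
  qed
  define Xs where "Xs = (\<lambda>z. {X. X \<subseteq> {..<2*n} - (P z \<union> R z) \<and> card X = l - 2})"
  define s where "s = (\<lambda>(z, X). X \<union> {Min (P z), Min (R z)})"
  define t where "t = (\<lambda>(z, X). X \<union> {Max (P z), Max (R z)})"
  define V where "V = {U. U \<subseteq> {..<2*n} \<and> card U = l}"
  define F where "F = (\<lambda>U b. \<Sum>v\<in>U. f (v mod n) (restrict_msg k L b))"
  have cardI: "card (Sigma (Q i) Xs) = card (Q i) * ((2 * n - 4) choose (l - 2))" for i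
    unfolding Xs_def
    by (rule kikuchi_conflicts(2)[OF finQ QP QR n l d both left right all])
  have edge: "s (z, X) \<in> V \<and> t (z, X) \<in> V \<and> s (z, X) \<noteq> t (z, X)
      \<and> (b \<in> carrier_vec k \<longrightarrow> F (s (z, X)) b + F (t (z, X)) b = b $ i)"
    if i: "i < k" and z: "z \<in> Q i" and X: "X \<in> Xs z" for i z X b
  proof -
    obtain A w B where zz: "z = (A, w, B)" by (cases z)
    note zD = QD[OF z[unfolded zz]]
    note ABw = ZD[OF zD(1)]
    define x x' y y' where xy: "x = Min (P z)" "x' = Max (P z)" "y = Min (R z)" "y' = Max (R z)"
    have Pz: "P z = {x, x'}" "x \<noteq> x'" and Rz: "R z = {y, y'}" "y \<noteq> y'"
      unfolding xy using card_2_Min_Max(3,4)[of "P z"] card_2_Min_Max(3,4)[of "R z"] QP[OF z] QR[OF z]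
      by blast+
    have lt: "x < n" "x' < n" "n \<le> y" "n \<le> y'" "y < 2 * n" "y' < 2 * n"
      using QP[OF z] QR[OF z] unfolding Pz Rz by auto
    have Xsub: "X \<subseteq> {..<2*n}" "card X = l - 2" "x \<notin> X" "x' \<notin> X" "y \<notin> X" "y' \<notin> X"
      using X unfolding Xs_def Pz Rz by auto
    have finX: "finite X" using Xsub(1) finite_subset by blast
    have sX: "s (z, X) = insert x (insert y X)" and tX: "t (z, X) = insert x' (insert y' X)"
      by (auto simp: s_def t_def xy)
    have nxy: "x \<noteq> y" "x' \<noteq> y'" "x \<noteq> y'" using lt by auto
    have "s (z, X) \<in> V" "t (z, X) \<in> V"
      unfolding sX tX V_def using lt Xsub finX nxy l(1) by auto
    moreover have "s (z, X) \<noteq> t (z, X)"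
      unfolding sX tX using Xsub Pz(2) nxy by blast
    moreover have "F (s (z, X)) b + F (t (z, X)) b = b $ i" if b: "b \<in> carrier_vec k"
    proof -
      define m where "m = restrict_msg k L b"
      have mn: "x mod n = x" "x' mod n = x'" "y mod n = y - n" "y' mod n = y' - n"
        using lt by (auto simp: mod_if le_mod_geq)
      have A: "A = {w, x, x'}" "w \<notin> {x, x'}"
        using Pz(1) ABw(5) unfolding zz P_def by auto
      have B: "B = {w, y - n, y' - n}" "w \<notin> {y - n, y' - n}" "y - n \<noteq> y' - n"
      proof -
        have "(\<lambda>v. v - n) ` R z = B - {w}"
          unfolding zz R_def by (simp add: image_image)
        then have *: "B - {w} = {y - n, y' - n}" unfolding Rz by auto
        then show "B = {w, y - n, y' - n}" "w \<notin> {y - n, y' - n}" using ABw(6) by auto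
        show "y - n \<noteq> y' - n" using lt Rz(2) by linarith
      qed
      have "(\<Sum>v\<in>A. f v m) = f w m + (f x m + f x' m)"
        unfolding A(1) using A(2) Pz(2) by simp
      then have fA: "f w m + (f x m + f x' m) = b $ i"
        using f_sum[OF ABw(3), of m] zD i by (simp add: m_def)
      have "(\<Sum>v\<in>B. f v m) = f w m + (f (y - n) m + f (y' - n) m)"
        unfolding B(1) using B(2,3) by simp
      then have fB: "f w m + (f (y - n) m + f (y' - n) m) = 0"
        using f_sum[OF ABw(4), of m] zD lab_less[OF ABw(4)] by (simp add: m_def)
      define S where "S = (\<Sum>v\<in>X. f (v mod n) m)"
      have "F (s (z, X)) b + F (t (z, X)) b
        = (f x m + (f (y - n) m + S)) + (f x' m + (f (y' - n) m + S))"
        unfolding F_def sX tX m_def[symmetric] S_def using finX Xsub nxy by (simp add: mn)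
      also have "\<dots> = b $ i"
        by (rule bit_sum_cancel[OF fA fB])
      finally show ?thesis .
    qed
    ultimately show ?thesis by blast
  qed
  show ?thesis
  proof (rule linear_wLDC_2_of_edges[where I = "\<lambda>i. Sigma (Q i) Xs" and s = s and t = t and V = V
        and F = F and D = "28 * real d"])
    show "finite V" by (simp add: V_def)
    show "card V = 2 * n choose l" using n_subsets[of "{..<2*n}" l] by (simp add: V_def)
    show "additive_functional k (F U)" if "U \<in> V" for U
      unfolding F_def using n by (intro additive_functional_sum additive_functional_restrict f_additive) auto
    show "finite (Sigma (Q i) Xs)" for i using finQ by (auto simp: Xs_def)
    show "s a \<in> V \<and> t a \<in> V \<and> s a \<noteq> t a" if ia: "i < k" "a \<in> Sigma (Q i) Xs" for i a
      using edge[OF ia(1)] ia(2) by auto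
    show "F (s a) b + F (t a) b = b $ i" if ia: "i < k" "a \<in> Sigma (Q i) Xs" "b \<in> carrier_vec k" for i a b
      using edge[OF ia(1)] ia(2,3) by auto
    show "(\<Sum>a\<in>Sigma (Q i) Xs. real (card {b \<in> Sigma (Q i) Xs. {s a, t a} \<inter> {s b, t b} \<noteq> {}}))
        \<le> 28 * real d * real (card (Sigma (Q i) Xs))" for i
      unfolding s_def t_def Xs_def
      by (rule kikuchi_conflicts(1)[OF finQ QP QR n l d both left right all])
    have "(\<Sum>i<k. card (Q i)) = card {z\<in>Z. la z \<in> L \<and> lb z \<notin> L}"
      unfolding Q_def using finZ lab_lt by (intro card_eq_sum_fibers) auto
    then have "card Z \<le> 4 * (\<Sum>i<k. card (Q i))" using L by simp
    then have "real (card Z) \<le> real (4 * (\<Sum>i<k. card (Q i)))" by (rule of_nat_mono)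
    then have "real (card Z) * real ((2 * n - 4) choose (l - 2))
        \<le> real (4 * (\<Sum>i<k. card (Q i))) * real ((2 * n - 4) choose (l - 2))"
      by (intro mult_right_mono) auto
    also have "\<dots> = 4 * (\<Sum>i<k. real (card (Sigma (Q i) Xs)))"
      by (simp add: cardI sum_distrib_right)
    finally show "4 * (28 * real d) * (\<delta> * real (2 * n choose l) * real k)
        \<le> (\<Sum>i<k. real (card (Sigma (Q i) Xs)))"
      using total by (simp add: Z_def)
  qed (use d in simp)
qed

end

section \<open>The trade-off\<close>

lemma wLDC_2_of_nonpos:
  assumes "\<delta> * real n * real k \<le> 0"
  shows "\<exists>C. linear_wLDC 2 \<delta> k n C"
  by (rule linear_wLDC_2_of_edges[where I = "\<lambda>_. {} :: nat set" and V = "{..<n}" and F = "\<lambda>_ _. 0"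
        and D = 1 and s = id and t = id])
    (use assms in \<open>auto simp: additive_functional_def mult_ac\<close>)

text \<open>Bit 0 is written at the even positions and zero at the odd ones, so each pair of
  neighbours 2a, 2a + 1 decodes it. The other bits get no queries.\<close>

lemma wLDC_2_one_message_bit:
  assumes k: "k > 0" and total: "4 * (\<delta> * real n * real k) \<le> real (n div 2)"
  shows "\<exists>C. linear_wLDC 2 \<delta> k n C"
proof -
  define I where "I = (\<lambda>i::nat. if i = 0 then {..<n div 2} else {})"
  define F where "F = (\<lambda>(v::nat) (b :: bit vec). if even v then b $ 0 else 0)"
  show ?thesis
  proof (rule linear_wLDC_2_of_edges[where I = I and V = "{..<n}" and F = F
        and D = 1 and s = "\<lambda>a. 2 * a" and t = "\<lambda>a. 2 * a + 1"])
    show "additive_functional k (F v)" for v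
      using k by (auto simp: F_def additive_functional_def)
    show "F (2 * a) b + F (2 * a + 1) b = b $ i" if "a \<in> I i" for i a b
      using that by (auto simp: I_def F_def split: if_splits)
    show "2 * a \<in> {..<n} \<and> 2 * a + 1 \<in> {..<n} \<and> 2 * a \<noteq> 2 * a + 1" if "a \<in> I i" for i a
      using that by (auto simp: I_def split: if_splits)
    show "(\<Sum>a\<in>I i. real (card {b \<in> I i. {2 * a, 2 * a + 1} \<inter> {2 * b, 2 * b + 1} \<noteq> {}}))
        \<le> 1 * real (card (I i))" for i
    proof -
      have "{b \<in> I i. {2 * a, 2 * a + 1} \<inter> {2 * b, 2 * b + 1} \<noteq> {}} = {a}" if "a \<in> I i" for a
        using that by (auto; presburger)
      then show ?thesis by simp
    qed
    have "(\<Sum>i<k. real (card (I i))) = (\<Sum>i\<in>{..<k}. if i = 0 then real (n div 2) else 0)"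
      by (intro sum.cong) (auto simp: I_def)
    then show "4 * 1 * (\<delta> * real n * real k) \<le> (\<Sum>i<k. real (card (I i)))"
      using total k by simp
  qed (auto simp: I_def)
qed

lemma (in labelled_triples) card_T_le: "card T \<le> n * k"
proof -
  have "T \<subseteq> (\<Union>v<n. {A\<in>T. v \<in> A})"
  proof
    fix A assume A: "A \<in> T"
    then have "A \<noteq> {}" using T_card by force
    then show "A \<in> (\<Union>v<n. {A\<in>T. v \<in> A})" using A T_sub[OF A] by blast
  qed
  then have "card T \<le> card (\<Union>v<n. {A\<in>T. v \<in> A})" using finite_T by (intro card_mono) auto
  also have "\<dots> \<le> (\<Sum>v<n. card {A\<in>T. v \<in> A})" by (rule card_UN_le) simp
  also have "\<dots> \<le> (\<Sum>v<n. k)" by (intro sum_mono card_star_le)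
  finally show ?thesis by simp
qed

text \<open>Decoding the i-th unit vector shows that no triple belongs to the matchings of two
  different bits. Hence labels are well defined and the union of the matchings loses nothing in
  size.\<close>

lemma labelled_triples_of_wLDC_3:
  assumes "linear_wLDC 3 \<delta> k n C"
  obtains T lab where "labelled_triples k n T lab (\<lambda>v b. C b $ v)" "\<delta> * real n * real k \<le> real (card T)"
proof -
  obtain H :: "nat \<Rightarrow> nat set set" where lin: "linear_code k n C"
    and H': "\<forall>i<k. hypergraph_on {..<n} (H i) \<and> uniform_hypergraph 3 (H i) \<and> hypergraph_matching (H i)"
    and total: "\<delta> * real n * real k \<le> real (\<Sum>i<k. card (H i))"
    and dec': "\<forall>i<k. \<forall>e\<in>H i. \<forall>b\<in>carrier_vec k. (\<Sum>v\<in>e. C b $ v) = b $ i"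
    using assms unfolding linear_wLDC_def by (elim exE conjE) (rule that)
  have H: "hypergraph_on {..<n} (H i) \<and> uniform_hypergraph 3 (H i) \<and> hypergraph_matching (H i)"
    if "i < k" for i
    using H' that by blast
  have dec: "(\<Sum>v\<in>e. C b $ v) = b $ i" if "i < k" "e \<in> H i" "b \<in> carrier_vec k" for i e b
    using dec' that by blast
  have uniq: "i = j" if "i < k" "j < k" "A \<in> H i" "A \<in> H j" for i j A
  proof -
    have "unit_vec k i $ i = (unit_vec k i :: bit vec) $ j"
      using dec[OF that(1,3), of "unit_vec k i"] dec[OF that(2,4), of "unit_vec k i"] by simp
    then show ?thesis using that by (simp split: if_splits)
  qed
  define T where "T = (\<Union>i<k. H i)"
  define lab where "lab = (\<lambda>A. THE i. i < k \<and> A \<in> H i)"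
  have lab: "lab A = i" if "i < k" "A \<in> H i" for A i
    unfolding lab_def using that uniq by (intro the_equality) auto
  have TD: "lab A < k" "A \<in> H (lab A)" if "A \<in> T" for A
    using that lab by (auto simp: T_def)
  have sub: "A \<subseteq> {..<n}" "card A = 3" if "A \<in> T" for A
    using H[OF TD(1)[OF that]] TD(2)[OF that]
    by (auto simp: hypergraph_on_def uniform_hypergraph_def)
  have "labelled_triples k n T lab (\<lambda>v b. C b $ v)"
  proof
    show "A = B" if "A \<in> T" "B \<in> T" "lab A = lab B" "v \<in> A" "v \<in> B" for A B v
    proof (rule ccontr)
      assume "A \<noteq> B"
      moreover have "disjoint (H (lab A))"
        using H[OF TD(1)[OF that(1)]] by (simp add: hypergraph_matching_def)
      moreover have "A \<in> H (lab A)" "B \<in> H (lab A)"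
        using TD(2)[OF that(1)] TD(2)[OF that(2)] that(3) by simp_all
      ultimately have "A \<inter> B = {}" by (meson disjointD)
      then show False using that by blast
    qed
    show "additive_functional k (\<lambda>b. C b $ v)" if "v < n" for v
      unfolding additive_functional_def
    proof (intro ballI)
      fix x y :: "bit vec" assume xy: "x \<in> carrier_vec k" "y \<in> carrier_vec k"
      have "C (x + y) = C x + C y" "C y \<in> carrier_vec n"
        using lin xy unfolding linear_code_def by blast+
      then show "C (x + y) $ v = C x $ v + C y $ v" using that by simp
    qed
    show "(\<Sum>v\<in>A. C b $ v) = b $ lab A" if "A \<in> T" "b \<in> carrier_vec k" for A b
      using dec TD that by blast
  qed (use sub TD in auto)
  moreover have "card T = (\<Sum>i<k. card (H i))"
    unfolding T_def
  proof (rule card_UN_disjoint)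
    show "\<forall>i\<in>{..<k}. finite (H i)"
      using H by (auto simp: hypergraph_on_def intro: finite_subset[of _ "Pow {..<n}"])
    show "\<forall>i\<in>{..<k}. \<forall>j\<in>{..<k}. i \<noteq> j \<longrightarrow> H i \<inter> H j = {}"
      using uniq by blast
  qed simp
  ultimately show ?thesis using that total by simp
qed

text \<open>With x = sqrt (n / k) > 2, rounding x / 2 up stays between x / 2 and x. So l^2 is within
  a factor 4 of n / k, and l >= 2 leaves room for one vertex from each copy.\<close>

lemma kikuchi_level_2_bounds:
  assumes k: "k > 0" and n: "4 * k < n"
  shows "2 \<le> kikuchi_level 2 n k" "kikuchi_level 2 n k \<le> n"
    "k * (kikuchi_level 2 n k)\<^sup>2 \<le> n" "real n \<le> 4 * real k * (real (kikuchi_level 2 n k))\<^sup>2"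
proof -
  define x where "x = sqrt (real n / real k)"
  define l where "l = kikuchi_level 2 n k"
  have "real (4 * k) < real n" using n by (simp only: of_nat_less_iff)
  then have "4 < real n / real k" using k by (simp add: field_simps)
  then have "sqrt 4 < x" unfolding x_def by (rule real_sqrt_less_mono)
  then have x: "2 < x" by simp
  have x2: "x\<^sup>2 = real n / real k" by (simp add: x_def)
  have l: "l = nat \<lceil>x / 2\<rceil>" by (simp add: l_def kikuchi_level_def x_def)
  have rl: "real l = real_of_int \<lceil>x / 2\<rceil>" using x by (simp add: l)
  have lower: "x / 2 \<le> real l" unfolding rl by (rule le_of_int_ceiling)
  have upper: "real l \<le> x" unfolding rl using x by linarith
  show l2: "2 \<le> kikuchi_level 2 n k" using lower x unfolding l_def[symmetric] by linarith
  have "(real l)\<^sup>2 \<le> x\<^sup>2" using upper by (intro power_mono) auto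
  then have "real k * (real l)\<^sup>2 \<le> real n" using k unfolding x2 by (simp add: field_simps)
  then have "real (k * l\<^sup>2) \<le> real n" by simp
  then show kl: "k * (kikuchi_level 2 n k)\<^sup>2 \<le> n" unfolding l_def by (simp only: of_nat_le_iff)
  have "l \<le> l\<^sup>2" using l2 by (simp add: power2_eq_square l_def)
  also have "\<dots> \<le> k * l\<^sup>2" using k by simp
  finally show "kikuchi_level 2 n k \<le> n" using kl by (simp add: l_def)
  have "x\<^sup>2 \<le> (2 * real l)\<^sup>2" using lower x by (intro power_mono) auto
  then have "real n \<le> 4 * real k * (real l)\<^sup>2" using k unfolding x2 by (simp add: field_simps power2_eq_square)
  then show "real n \<le> 4 * real k * (real (kikuchi_level 2 n k))\<^sup>2" by (simp add: l_def)
qed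

text \<open>In this range the required length is 2n choose 1, that is 2n: a code on the n original
  coordinates only has to be padded.\<close>

lemma kikuchi_level_2_eq_1:
  assumes "k > 0" "n > 0" "n \<le> 4 * k"
  shows "kikuchi_level 2 n k = 1"
proof -
  have "real n \<le> real (4 * k)" using assms(3) by (simp only: of_nat_le_iff)
  then have "real n / real k \<le> 4" "real n / real k > 0" using assms by (auto simp: field_simps)
  then have "sqrt (real n / real k) \<le> 2" "sqrt (real n / real k) > 0"
    using real_sqrt_le_mono[of "real n / real k" 4] by simp_all
  then have "\<lceil>sqrt (real n / real k) / 2\<rceil> = 1" by (intro ceiling_unique) auto
  then show ?thesis by (simp add: kikuchi_level_def)
qed

section \<open>Numerical parameters for few and for many vertices\<close>

context labelled_triples
begin

text \<open>With y = \<delta>k/2, zeroing t <= y coordinates gains at least 2ty pairs and loses at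
  most t^2 <= ty of them. If t < n, then t >= y/2 and n <= 4k give ty >= \<delta>^2 k n / 32; if t =
  n, the same follows from \<delta> <= 1. The constant 256 is 32 times the factor 8 in
  \<open>4 * (\<epsilon> * real (2 * n) * real k)\<close>.\<close>

lemma wLDC_2_few_vertices:
  assumes \<delta>: "\<delta> * real n * real k \<le> real (card T)" "0 < \<delta>" "2 \<le> \<delta> * real k"
    and n: "0 < n" "n \<le> 4 * k" and \<epsilon>: "\<epsilon> \<le> \<delta>\<^sup>2 / 256"
  shows "\<exists>C. linear_wLDC 2 \<epsilon> k (2 * n) C"
proof -
  have k: "k > 0" using n by simp
  have "\<delta> * real (n * k) \<le> real (n * k)"
    using \<delta>(1) of_nat_mono[OF card_T_le, where 'a = real] by (simp add: mult.assoc)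
  then have \<delta>1: "\<delta> \<le> 1" using n k by (simp add: mult_le_cancel_right1)
  define y where "y = \<delta> * real k / 2"
  define t where "t = min n (nat \<lfloor>y\<rfloor>)"
  have y1: "1 \<le> y" using \<delta>(3) by (simp add: y_def)
  have ty: "real t \<le> y" unfolding t_def using y1 by linarith
  have "1 \<le> \<lfloor>y\<rfloor>" using y1 by simp
  then have "y / 2 \<le> real_of_int \<lfloor>y\<rfloor>" by linarith
  then have "y / 2 \<le> real (nat \<lfloor>y\<rfloor>)" using y1 by simp
  then have t: "t = n \<or> y / 2 \<le> real t" by (auto simp: t_def min_def)
  have "\<delta>\<^sup>2 * real k * real n / 32 \<le> real t * y"
  proof (cases "t = n")
    case True
    have "\<delta> * \<delta> * (real k * real n) \<le> \<delta> * 1 * (real k * real n)"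
      using \<delta>1 \<delta>(2) by (intro mult_right_mono mult_left_mono) auto
    moreover have "real t * y = \<delta> * (real k * real n) / 2" using True by (simp add: y_def)
    moreover have "0 \<le> \<delta> * (real k * real n)" using \<delta>(2) by simp
    ultimately show ?thesis by (simp add: power2_eq_square mult.assoc)
  next
    case False
    have "real n \<le> real (4 * k)" using n(2) by (simp only: of_nat_le_iff)
    then have "\<delta>\<^sup>2 * real k * real n \<le> \<delta>\<^sup>2 * real k * real (4 * k)"
      by (intro mult_left_mono) auto
    then have "\<delta>\<^sup>2 * real k * real n / 32 \<le> y / 2 * y" by (simp add: y_def power2_eq_square mult_ac)
    also have "\<dots> \<le> real t * y" using False t y1 by (intro mult_right_mono) auto
    finally show ?thesis .
  qed
  moreover have "real t * (2 * y) \<le> real t * real (card T) / real n"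
  proof -
    have "2 * y \<le> real (card T) / real n" using \<delta>(1) n by (simp add: y_def field_simps)
    then have "real t * (2 * y) \<le> real t * (real (card T) / real n)" by (intro mult_left_mono) auto
    then show ?thesis by simp
  qed
  moreover have "real t ^ 2 \<le> real t * y"
    unfolding power2_eq_square using ty by (intro mult_left_mono) auto
  ultimately have main: "\<delta>\<^sup>2 * real k * real n / 32 \<le> real t * real (card T) / real n - real t ^ 2"
    by linarith
  have "\<epsilon> * (real n * real k) \<le> \<delta>\<^sup>2 / 256 * (real n * real k)"
    using \<epsilon> by (intro mult_right_mono) auto
  then have "4 * (\<epsilon> * real (2 * n) * real k) \<le> \<delta>\<^sup>2 * real k * real n / 32"
    by (simp add: mult_ac)
  from order.trans[OF this main] show ?thesis
    by (intro wLDC_2_of_vanishing[of t "{..<2*n}"]) (simp_all add: t_def)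
qed

text \<open>As \<delta>k >= 2, W has at least n triples, which absorbs the diagonal term of the
  Cauchy-Schwarz bound and leaves 6 |W|^2 / n intersecting pairs. With n <= 4kl^2, the number of
  l-subsets is at most 256 n k times the edges of one 4-query. What remains is 448 * 512 / 3 <
  1000000.\<close>

lemma wLDC_2_light:
  assumes W: "W \<subseteq> T" "\<delta> * real n * real k \<le> 2 * real (card W)" and \<delta>: "2 \<le> \<delta> * real k"
    and light: "\<And>p. card p = 2 \<Longrightarrow> card {A\<in>W. p \<subseteq> A} \<le> d" and d: "1 \<le> d"
    and n: "4 * k < n" and k: "0 < k"
  shows "\<exists>C. linear_wLDC 2 (1 / 1000000 * (\<delta>\<^sup>2 / real d)) k (2 * n choose kikuchi_level 2 n k) C"
proof -
  define l where "l = kikuchi_level 2 n k"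
  define N where "N = real (2 * n choose l)"
  define K where "K = real ((2 * n - 4) choose (l - 2))"
  define z where "z = real (card (intersecting W))"
  define w where "w = real (card W)"
  note l = kikuchi_level_2_bounds[OF k n, folded l_def]
  have npos: "real n > 0" "real k > 0" using n k by auto
  have wn: "real n \<le> w"
  proof -
    have "real n * 2 \<le> real n * (\<delta> * real k)" using \<delta> by (intro mult_left_mono) auto
    then show ?thesis using W(2) by (simp add: w_def mult_ac)
  qed
  have "9 * w\<^sup>2 \<le> real n * (z + 3 * w)"
    using card_intersecting_ge[OF W(1)] by (simp add: w_def z_def)
  moreover have "real n * w \<le> w\<^sup>2"
    unfolding power2_eq_square using wn npos by (intro mult_right_mono) auto
  ultimately have z6: "6 * w\<^sup>2 \<le> real n * z" by (simp add: algebra_simps)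
  have "0 \<le> \<delta> * real k" using \<delta> by linarith
  then have "0 \<le> real n * (\<delta> * real k)" by (rule mult_nonneg_nonneg[OF of_nat_0_le_iff])
  then have "(\<delta> * real n * real k)\<^sup>2 \<le> (2 * w)\<^sup>2"
    using W(2) by (intro power_mono) (auto simp: w_def mult_ac)
  then have "3 * (\<delta> * real n * real k)\<^sup>2 \<le> 2 * (real n * z)" using z6 by (simp add: power_mult_distrib)
  then have "real n * (3 * \<delta>\<^sup>2 * real n * (real k)\<^sup>2) \<le> real n * (2 * z)"
    by (simp add: power_mult_distrib power2_eq_square mult_ac)
  then have z: "3 * \<delta>\<^sup>2 * real n * (real k)\<^sup>2 \<le> 2 * z"
    using npos(1) by (rule mult_left_le_imp_le)
  have "N * (real l)\<^sup>2 \<le> 64 * (real n)\<^sup>2 * K"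
    using binomial_descend_four[of n l] l n by (simp add: N_def K_def)
  moreover have "N * real n \<le> N * (4 * real k * (real l)\<^sup>2)"
    using l(4) by (intro mult_left_mono) (auto simp: N_def)
  moreover have "N * (4 * real k * (real l)\<^sup>2) = 4 * real k * (N * (real l)\<^sup>2)" by simp
  moreover have "4 * real k * (N * (real l)\<^sup>2) \<le> 4 * real k * (64 * (real n)\<^sup>2 * K)"
    if "N * (real l)\<^sup>2 \<le> 64 * (real n)\<^sup>2 * K"
    using that by (intro mult_left_mono) auto
  ultimately have "N * real n \<le> 4 * real k * (64 * (real n)\<^sup>2 * K)" by linarith
  then have "real n * N \<le> real n * (256 * real n * real k * K)"
    by (simp add: power2_eq_square mult_ac)
  then have N: "N \<le> 256 * real n * real k * K"
    using npos(1) by (rule mult_left_le_imp_le)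
  have "\<delta>\<^sup>2 * real k * N \<le> \<delta>\<^sup>2 * real k * (256 * real n * real k * K)"
    using N by (intro mult_left_mono) auto
  also have "\<dots> = 256 / 3 * ((3 * \<delta>\<^sup>2 * real n * (real k)\<^sup>2) * K)"
    by (simp add: power2_eq_square)
  also have "\<dots> \<le> 256 / 3 * ((2 * z) * K)"
    using z by (intro mult_left_mono mult_right_mono) (auto simp: K_def)
  finally have fin: "\<delta>\<^sup>2 * real k * N \<le> 512 / 3 * (z * K)" by simp
  have "448 * real d * (1 / 1000000 * (\<delta>\<^sup>2 / real d) * N * real k) = 448 / 1000000 * (\<delta>\<^sup>2 * real k * N)"
    using d by (simp add: field_simps)
  also have "\<dots> \<le> 448 / 1000000 * (512 / 3 * (z * K))" using fin by (intro mult_left_mono) auto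
  also have "\<dots> \<le> z * K"
  proof -
    have "0 \<le> z * K" by (simp add: z_def K_def)
    then show ?thesis by linarith
  qed
  finally have "448 * real d * (1 / 1000000 * (\<delta>\<^sup>2 / real d) * real (2 * n choose l) * real k)
      \<le> real (card (intersecting W)) * real ((2 * n - 4) choose (l - 2))"
    by (simp add: N_def z_def K_def)
  then show ?thesis
    unfolding l_def[symmetric]
    using W(1) d light n k l(1-3) by (intro wLDC_2_kikuchi) auto
qed

end

theorem theoremB3:
  "\<exists>c c\<^sub>2 c\<^sub>3 :: real. c > 0 \<and> c\<^sub>2 > 0 \<and> c\<^sub>3 > 0 \<and>
     (\<forall>(k::nat) (n::nat) (d::nat) (\<delta>::real) (C :: bit vec \<Rightarrow> bit vec).
        k > 0 \<longrightarrow> d > 0 \<longrightarrow> linear_wLDC 3 \<delta> k n C \<longrightarrow>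
        (\<exists>(k\<^sub>2::nat) (k\<^sub>3::nat) (C\<^sub>2 :: bit vec \<Rightarrow> bit vec) (C\<^sub>3 :: bit vec \<Rightarrow> bit vec).
           real k\<^sub>2 \<ge> real k / 2 \<and> real k\<^sub>3 \<ge> real k / 2 \<and>
           (linear_wLDC 2 (c\<^sub>2 * (\<delta> * (real d / (real d + real k)))) k\<^sub>2 n C\<^sub>2 \<or>
            linear_wLDC 2 (c\<^sub>3 * (\<delta>\<^sup>2 / real d)) k\<^sub>3
              ((2 * n) choose kikuchi_level c n k) C\<^sub>3)))"
proof (rule exI[of _ 2], rule exI[of _ "1/64"], rule exI[of _ "1/1000000"], intro conjI allI impI)
  fix k n d :: nat and \<delta> :: real and C :: "bit vec \<Rightarrow> bit vec"
  assume k: "k > 0" and d: "d > 0" and C: "linear_wLDC 3 \<delta> k n C"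
  define q where "q = real d / (real d + real k)"
  \<comment> \<open>1/64 is 1/32 from the star construction, halved because the stars may cover only
    half of the triples.\<close>
  define \<epsilon>2 where "\<epsilon>2 = 1/64 * (\<delta> * q)"
  define \<epsilon>3 where "\<epsilon>3 = 1/1000000 * (\<delta>\<^sup>2 / real d)"
  define N where "N = (2 * n) choose kikuchi_level 2 n k"
  have q: "0 \<le> q" "q \<le> 1" using d by (auto simp: q_def)
  have "(\<exists>C\<^sub>2. linear_wLDC 2 \<epsilon>2 k n C\<^sub>2) \<or> (\<exists>C\<^sub>3. linear_wLDC 2 \<epsilon>3 k N C\<^sub>3)"
  proof (cases "\<delta> * real n * real k \<le> 0")
    case True
    have "\<epsilon>2 * real n * real k = q / 64 * (\<delta> * real n * real k)" by (simp add: \<epsilon>2_def)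
    also have "\<dots> \<le> 0" by (rule mult_nonneg_nonpos[OF _ True]) (use q in simp)
    finally show ?thesis using wLDC_2_of_nonpos by blast
  next
    case False
    then have pos: "\<delta> > 0" "n > 0" using k by (auto simp: not_le zero_less_mult_iff)
    obtain T lab where lt: "labelled_triples k n T lab (\<lambda>v b. C b $ v)"
      and T: "\<delta> * real n * real k \<le> real (card T)"
      by (rule labelled_triples_of_wLDC_3[OF C])
    interpret labelled_triples k n T lab "\<lambda>v b. C b $ v" by (rule lt)
    have "T \<noteq> {}" using T False by auto
    then obtain A where A: "A \<in> T" by blast
    have n3: "3 \<le> n" using card_mono[OF _ T_sub[OF A]] T_card[OF A] by simp
    \<comment> \<open>The threshold 2 guarantees at least one coordinate to zero in the second case,
      and at least n surviving triples if the light construction is used in the third. The threshold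
      4k is where the level jumps from 1 to 2.\<close>
    consider "\<delta> * real k < 2" | "2 \<le> \<delta> * real k" "n \<le> 4 * k" | "2 \<le> \<delta> * real k" "4 * k < n"
      by linarith
    then show ?thesis
    proof cases
      case 1
      have "q * (\<delta> * real k) \<le> 1 * 2" using 1 q pos by (intro mult_mono) auto
      then have "real n * (q * (\<delta> * real k)) \<le> real n * 2" by (intro mult_left_mono) auto
      then have "4 * (\<epsilon>2 * real n * real k) \<le> real n / 8" by (simp add: \<epsilon>2_def mult_ac)
      also have "\<dots> \<le> real (n div 2)" using n3 by linarith
      finally show ?thesis using wLDC_2_one_message_bit[OF k] by blast
    next
      case 2
      have "\<delta>\<^sup>2 / real d \<le> \<delta>\<^sup>2 / 1" using d by (intro divide_left_mono) auto
      moreover have "0 \<le> \<delta>\<^sup>2" by simp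
      ultimately have "\<epsilon>3 \<le> \<delta>\<^sup>2 / 256" unfolding \<epsilon>3_def by linarith
      then have "\<exists>C. linear_wLDC 2 \<epsilon>3 k (2 * n) C"
        using wLDC_2_few_vertices T pos 2 by blast
      then show ?thesis using kikuchi_level_2_eq_1 k pos 2 by (simp add: N_def)
    next
      case 3
      obtain \<G> where \<G>: "\<forall>G\<in>\<G>. G \<subseteq> T \<and> card G = d + 1 \<and> (\<exists>p. card p = 2 \<and> (\<forall>A\<in>G. p \<subseteq> A))"
        "disjoint \<G>" "\<forall>p. card p = 2 \<longrightarrow> card {A \<in> T - \<Union>\<G>. p \<subseteq> A} < d + 1"
        using star_partition[OF finite_T zero_less_Suc[of d]] unfolding Suc_eq_plus1
        by (elim exE conjE) (rule that)
      show ?thesis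
      proof (cases "card T \<le> 2 * card (\<Union>\<G>)")
        case True
        then have half: "\<delta> * real n * real k \<le> 2 * real (card (\<Union>\<G>))" using T by linarith
        have "32 * (real d + real k) * (\<epsilon>2 * real n * real k) = (\<delta> * real n * real k) / 2 * real d"
          using d by (simp add: \<epsilon>2_def q_def field_simps)
        also have "\<dots> \<le> real (card (\<Union>\<G>)) * real d" using half by (intro mult_right_mono) auto
        finally show ?thesis using wLDC_2_of_stars[of \<G> d] \<G>(1,2) d by blast
      next
        case False
        have sub: "\<Union>\<G> \<subseteq> T" using \<G>(1) by blast
        have "card (T - \<Union>\<G>) = card T - card (\<Union>\<G>)"
          using sub finite_T finite_subset by (intro card_Diff_subset) auto
        then have "card T \<le> 2 * card (T - \<Union>\<G>)" using False by linarith
        then have "\<delta> * real n * real k \<le> 2 * real (card (T - \<Union>\<G>))" using T by linarith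
        moreover have "card {A \<in> T - \<Union>\<G>. p \<subseteq> A} \<le> d" if "card p = 2" for p
          using \<G>(3) that by (simp add: less_Suc_eq_le)
        ultimately show ?thesis
          using wLDC_2_light[of "T - \<Union>\<G>" \<delta> d] 3 d k unfolding \<epsilon>3_def N_def by auto
      qed
    qed
  qed
  then show "\<exists>(k\<^sub>2::nat) (k\<^sub>3::nat) (C\<^sub>2 :: bit vec \<Rightarrow> bit vec) (C\<^sub>3 :: bit vec \<Rightarrow> bit vec).
           real k\<^sub>2 \<ge> real k / 2 \<and> real k\<^sub>3 \<ge> real k / 2 \<and>
           (linear_wLDC 2 (1/64 * (\<delta> * (real d / (real d + real k)))) k\<^sub>2 n C\<^sub>2 \<or>
            linear_wLDC 2 (1/1000000 * (\<delta>\<^sup>2 / real d)) k\<^sub>3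
              ((2 * n) choose kikuchi_level 2 n k) C\<^sub>3)"
    unfolding \<epsilon>2_def \<epsilon>3_def q_def N_def
    by (intro exI[of _ k] conjI) auto
qed auto

end
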